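(* Consider the meteor process $\mathcal{M}_t=\{M^x_t, x\in\mathbb{Z}\}$ on $\mathbb{Z}$ in the stationary regime, i.e., suppose that the distribution of $\mathcal{M}_0$ is $Q_\infty$. For $x\in\mathbb{Z}$ and $t\ge 0$ let $$F^x_t=\frac12\sum_{0\le s\le t}\left((N^x_s-N^x_{s-})M^x_{s-}-(N^{x+1}_s-N^{x+1}_{s-})M^{x+1}_{s-}\right)$$ be the net flow of mass from $x$ to $x+1$ on the time interval $[0,t]$. Then for every $t\ge 0$, $$\operatorname{Var}F^{0}_t\le 2.$$
   Context: Meteor process on a connected simple graph with vertex set $V$ and bounded degrees: let $N^v$, $v\in V$, be independent Poisson processes with intensity 1, independent of the initial masses $M^v_0\ge 0$. At each jump time $t$ of $N^v$, the mass at $v$ is distributed equally among the $d_v$ neighbors of $v$: $M^v_t=0$ and $M^x_t=M^x_{t-}+M^v_{t-}/d_v$ for every neighbor $x$ of $v$; the mass at a vertex does not change otherwise. On $\mathbb{Z}$, the neighbors of $x$ are $x-1$ and $x+1$ (so $d_x=2$), and $N^x$, $x\in\mathbb{Z}$, in the definition of $F^x_t$ are the Poisson processes driving $\mathcal{M}$. Definition of $Q_\infty$ (for $\mathbb{Z}$): let $\mathcal{C}_k$ be the circular graph with vertex set $\{1,\dots,k\}$ and edges $(j,j+1)$, $1\le j\le k-1$, and $(k,1)$. The meteor process on $\mathcal{C}_k$ with total mass $k$ has a unique stationary distribution $Q_k$. Identify the vertex set of $\mathcal{C}_k$ by translation with $\{1,\dots,k\}-\lfloor k/2\rfloor\subset\mathbb{Z}$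 and extend configurations $k$-periodically to $\mathbb{Z}$; thus $Q_k$ is viewed as a distribution on $\mathbb{R}^{\mathbb{Z}}$ (with the topology of pointwise convergence). $Q_\infty$ is the weak limit of $Q_k$ as $k\to\infty$ (this limit exists, and it is a stationary distribution for the meteor process on $\mathbb{Z}$). *)

theory Defs
  imports "HOL-Probability.Probability"
begin

section \<open>Poisson processes\<close>

text \<open>Processes are indexed by \<^typ>\<open>real\<close>, but only times \<open>t \<ge> 0\<close> are relevant. The left limit at time 0
  is the value at time 0 (no jump at time 0).\<close>

definition left_lim :: "(real \<Rightarrow> 'a::t2_space) \<Rightarrow> real \<Rightarrow> 'a" where
  "left_lim f t = (if t \<le> 0 then f t else Lim (at_left t) f)"

definition jump_time :: "(real \<Rightarrow> 'a::t2_space) \<Rightarrow> real \<Rightarrow> bool" where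
  "jump_time f t \<longleftrightarrow> f t \<noteq> left_lim f t"

definition poisson_process :: "'w measure \<Rightarrow> real \<Rightarrow> (real \<Rightarrow> 'w \<Rightarrow> nat) \<Rightarrow> bool" where
  "poisson_process \<Omega> r N \<longleftrightarrow>
     (\<forall>t\<ge>0. N t \<in> measurable \<Omega> (count_space UNIV)) \<and>
     (AE \<omega> in \<Omega>. N 0 \<omega> = 0 \<and> mono_on {0..} (\<lambda>t. N t \<omega>) \<and>
        (\<forall>t\<ge>0. continuous (at_right t) (\<lambda>s. N s \<omega>))) \<and>
     (\<forall>s t. 0 \<le> s \<longrightarrow> s < t \<longrightarrow>
        distr \<Omega> (count_space UNIV) (\<lambda>\<omega>. N t \<omega> - N s \<omega>) = measure_pmf (poisson_pmf (r * (t - s)))) \<and>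
     (\<forall>n (\<tau> :: nat \<Rightarrow> real). 0 \<le> \<tau> 0 \<longrightarrow> (\<forall>i<n. \<tau> i \<le> \<tau> (Suc i)) \<longrightarrow>
        prob_space.indep_vars \<Omega> (\<lambda>_. count_space UNIV)
          (\<lambda>i \<omega>. N (\<tau> (Suc i)) \<omega> - N (\<tau> i) \<omega>) {..<n})"

definition generated_events ::
  "'w measure \<Rightarrow> 'a measure \<Rightarrow> 'i set \<Rightarrow> ('i \<Rightarrow> 'w \<Rightarrow> 'a) \<Rightarrow> 'w set set" where
  "generated_events \<Omega> S I X =
     sigma_sets (space \<Omega>) (\<Union>i\<in>I. {X i -` A \<inter> space \<Omega> | A. A \<in> sets S})"


section \<open>The meteor process\<close>

text \<open>A graph is given by a vertex set \<open>V\<close> and an adjacency relation \<open>E\<close>.\<close>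

definition neighbors :: "'v set \<Rightarrow> ('v \<Rightarrow> 'v \<Rightarrow> bool) \<Rightarrow> 'v \<Rightarrow> 'v set" where
  "neighbors V E v = {x \<in> V. E v x}"

definition meteor_path ::
  "'v set \<Rightarrow> ('v \<Rightarrow> 'v \<Rightarrow> bool) \<Rightarrow> ('v \<Rightarrow> real \<Rightarrow> nat) \<Rightarrow> ('v \<Rightarrow> real \<Rightarrow> real) \<Rightarrow> bool" where
  "meteor_path V E N M \<longleftrightarrow>
     (\<forall>v\<in>V. \<forall>t>0. jump_time (N v) t \<longrightarrow>
        M v t = 0 \<and>
        (\<forall>x\<in>neighbors V E v.
           M x t = left_lim (M x) t + left_lim (M v) t / real (card (neighbors V E v)))) \<and>
     (\<forall>x\<in>V. \<forall>s t. 0 \<le> s \<longrightarrow> s < t \<longrightarrow>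
        (\<forall>y\<in>insert x (neighbors V E x). \<forall>u\<in>{s<..t}. \<not> jump_time (N y) u) \<longrightarrow> M x t = M x s)"

text \<open>The path property is only required almost surely: on the null event that two neighbors jump
  simultaneously, the rules above contradict each other in general. Joint independence of the
  processes \<open>N v\<close> and of the initial configuration is expressed by the generated
  sigma-algebras, the initial configuration having index \<^const>\<open>None\<close>.\<close>

definition meteor_process ::
  "'w measure \<Rightarrow> 'v set \<Rightarrow> ('v \<Rightarrow> 'v \<Rightarrow> bool) \<Rightarrow>
     ('v \<Rightarrow> real \<Rightarrow> 'w \<Rightarrow> nat) \<Rightarrow> ('v \<Rightarrow> real \<Rightarrow> 'w \<Rightarrow> real) \<Rightarrow> bool" where
  "meteor_process \<Omega> V E N M \<longleftrightarrow>
     prob_space \<Omega> \<and>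
     (\<forall>v\<in>V. poisson_process \<Omega> 1 (N v)) \<and>
     (\<forall>v\<in>V. \<forall>t\<ge>0. M v t \<in> borel_measurable \<Omega>) \<and>
     prob_space.indep_sets \<Omega>
       (\<lambda>i. case i of
              None \<Rightarrow> generated_events \<Omega> borel V (\<lambda>v. M v 0)
            | Some v \<Rightarrow> generated_events \<Omega> (count_space UNIV) {0..} (N v))
       (insert None (Some ` V)) \<and>
     (AE \<omega> in \<Omega>. (\<forall>v\<in>V. 0 \<le> M v 0 \<omega>) \<and>
        meteor_path V E (\<lambda>v s. N v s \<omega>) (\<lambda>v s. M v s \<omega>))"

definition config_law ::
  "'w measure \<Rightarrow> 'v set \<Rightarrow> ('v \<Rightarrow> real \<Rightarrow> 'w \<Rightarrow> real) \<Rightarrow> real \<Rightarrow> ('v \<Rightarrow> real) measure" where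
  "config_law \<Omega> V M t = distr \<Omega> (Pi\<^sub>M V (\<lambda>_. borel)) (\<lambda>\<omega>. \<lambda>v\<in>V. M v t \<omega>)"

text \<open>On the graphs below, the law of the meteor process is determined by its initial law,
  so it suffices to ask for one process with law \<open>Q\<close> at all times. The type argument is the type
  of the elements of the probability space carrying that process.\<close>

definition stationary_distribution ::
  "'w itself \<Rightarrow> 'v set \<Rightarrow> ('v \<Rightarrow> 'v \<Rightarrow> bool) \<Rightarrow> ('v \<Rightarrow> real) measure \<Rightarrow> bool" where
  "stationary_distribution W V E Q \<longleftrightarrow>
     (\<exists>(\<Omega> :: 'w measure) N M. meteor_process \<Omega> V E N M \<and> (\<forall>t\<ge>0. config_law \<Omega> V M t = Q))"


section \<open>The circular graphs, the integer line, and the limit distribution\<close>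

definition int_adj :: "int \<Rightarrow> int \<Rightarrow> bool" where
  "int_adj x y \<longleftrightarrow> y = x - 1 \<or> y = x + 1"

definition circle_vertices :: "nat \<Rightarrow> int set" where
  "circle_vertices k = {1..int k}"

definition circle_adj :: "nat \<Rightarrow> int \<Rightarrow> int \<Rightarrow> bool" where
  "circle_adj k i j \<longleftrightarrow>
     j = i + 1 \<or> i = j + 1 \<or> (i = int k \<and> j = 1) \<or> (i = 1 \<and> j = int k)"

definition circle_stationary :: "'w itself \<Rightarrow> nat \<Rightarrow> (int \<Rightarrow> real) measure \<Rightarrow> bool" where
  "circle_stationary W k Q \<longleftrightarrow>
     stationary_distribution W (circle_vertices k) (circle_adj k) Q \<and>
     (AE m in Q. (\<Sum>j\<in>circle_vertices k. m j) = real k)"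

text \<open>Vertex \<open>j\<close> of the circle is placed at \<open>j - \<lfloor>k/2\<rfloor>\<close>, and the configuration is
  continued with period \<open>k\<close>; hence the site \<open>x\<close> carries the mass of the vertex
  in \<open>{1..k}\<close> congruent to \<open>x + \<lfloor>k/2\<rfloor>\<close> modulo \<open>k\<close>.\<close>

definition periodic_extension :: "nat \<Rightarrow> (int \<Rightarrow> real) \<Rightarrow> int \<Rightarrow> real" where
  "periodic_extension k m x = m ((x + int (k div 2) - 1) mod int k + 1)"

definition periodic_law :: "nat \<Rightarrow> (int \<Rightarrow> real) measure \<Rightarrow> (int \<Rightarrow> real) measure" where
  "periodic_law k Q = distr Q (Pi\<^sub>M UNIV (\<lambda>_. borel)) (periodic_extension k)"

text \<open>The topology on \<^typ>\<open>int \<Rightarrow> real\<close> is that of pointwise convergence (the product topology).\<close>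

definition weakly_converges ::
  "(nat \<Rightarrow> 'a::topological_space measure) \<Rightarrow> 'a measure \<Rightarrow> bool" where
  "weakly_converges P Q \<longleftrightarrow>
     prob_space Q \<and> sets Q = sets borel \<and>
     (\<forall>f :: 'a \<Rightarrow> real. continuous_on UNIV f \<longrightarrow> bounded (range f) \<longrightarrow>
        (\<lambda>k. integral\<^sup>L (P k) f) \<longlonglongrightarrow> integral\<^sup>L Q f)"


section \<open>Net flow\<close>

text \<open>Almost surely, only finitely many terms of the sum are nonzero.\<close>

definition net_flow :: "(int \<Rightarrow> real \<Rightarrow> nat) \<Rightarrow> (int \<Rightarrow> real \<Rightarrow> real) \<Rightarrow> int \<Rightarrow> real \<Rightarrow> real" where
  "net_flow N M x t = 1/2 * (\<Sum>\<^sub>\<infinity>s\<in>{0..t}.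
     (real (N x s) - real (left_lim (N x) s)) * left_lim (M x) s
     - (real (N (x + 1) s) - real (left_lim (N (x + 1)) s)) * left_lim (M (x + 1)) s)"

text \<open>The flow of a process is determined only up to a null event, on which its paths are
  unconstrained, so it is a random variable on the completed space. Since the variance defined by
  the Bochner integral is 0 for functions that are not square integrable, a bound on the variance is
  stated together with square integrability.\<close>

definition flow_rv ::
  "(int \<Rightarrow> real \<Rightarrow> 'w \<Rightarrow> nat) \<Rightarrow> (int \<Rightarrow> real \<Rightarrow> 'w \<Rightarrow> real) \<Rightarrow> int \<Rightarrow> real \<Rightarrow> 'w \<Rightarrow> real" where
  "flow_rv N M x t \<omega> = net_flow (\<lambda>v s. N v s \<omega>) (\<lambda>v s. M v s \<omega>) x t"

end

theory Submission
  imports Defs "HOL-Real_Asymp.Real_Asymp"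
begin

text \<open>Between jumps nothing moves, so \<open>F\<^sup>0\<^sub>t\<close> is a linear function \<open>\<Sum>x. \<phi> x * M\<^sup>x\<^sub>0\<close> of the initial masses,
  with coefficients \<open>\<phi>\<close> that depend on the clocks only and have finite support, because a site without
  a jump in \<open>[0,t]\<close> lets no mass through. Read backwards in time, a jump of \<open>v\<close> replaces \<open>\<phi> v\<close> by the
  average over the neighbors plus a source (\<open>1/2\<close> at \<open>0\<close> and \<open>-1/2\<close> at \<open>1\<close>). With
  \<open>e x = \<phi> (x + 1) - \<phi> x + [x = 0]\<close>, such a jump lowers \<open>\<Sum>e\<^sup>2/2\<close> by exactly the square of the change
  of \<open>\<phi> v\<close>, while the expected change of \<open>\<Sum>\<phi>\<close> over a uniformly chosen \<open>v\<close> vanishes. Hence the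
  expectation of \<open>\<Sum>e\<^sup>2/2 + (\<Sum>\<phi>)\<^sup>2\<close> keeps its initial value \<open>1/2\<close>.

  On the other hand \<open>Q\<^sub>\<infinity>\<close> satisfies \<open>E (\<Sum>\<phi> M)\<^sup>2 \<le> \<Sum>(\<nabla>\<phi>)\<^sup>2/2 + (\<Sum>\<phi>)\<^sup>2\<close>: on the circle the two-point function
  of a stationary law is an invariant measure of an irreducible chain of two particles, which
  determines it, and the inequality survives the weak limit. Since \<open>(\<nabla>\<phi>)\<^sup>2 \<le> 2 e\<^sup>2 + 2 [x = 0]\<close>, this
  gives \<open>E F\<^sup>2 \<le> 2 * 1/2 + 1 = 2\<close>.

  Only finitely many sites and a time grid fine enough to separate their jumps are considered at once;
  Fatou's lemma removes both restrictions.\<close>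

section \<open>Paths with finitely many jumps\<close>

text \<open>Both halves of the argument rest on one quadratic form. The two-point function
  \<open>1 - circle_lap\<close> gives \<open>\<Sum>x. \<phi> x * m x\<close> the second moment
  \<open>(\<Sum>x. (\<phi> (x + 1) - \<phi> x)\<^sup>2) / 2 + (\<Sum>x. \<phi> x)\<^sup>2\<close>,
  and a dual chain without source preserves this form in mean. The source at 0 and 1 destroys the
  invariance; adding 1 to the gradient across the edge from 0 to 1 restores it, which is the origin
  of \<open>e\<close>. Returning from \<open>e\<close> to the gradient is the step that costs a
  factor 2 and an additive 1.

  The obstacle is that the masses are read off counts at grid times only if no cell contains two
  jumps and only between two silent sites, and for a fixed window and grid this can fail. Discarding
  the bad cases must not leave an error depending on the window or the mesh. It leaves none: the
  energy is nonnegative, so weights of total at most one can only lower its mean.\<close>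

definition counting_path :: "(real \<Rightarrow> nat) \<Rightarrow> bool" where
  "counting_path f \<longleftrightarrow> mono_on {0..} f \<and> (\<forall>t\<ge>0. continuous (at_right t) f)"

lemma counting_path_mono: "counting_path f \<Longrightarrow> 0 \<le> s \<Longrightarrow> s \<le> t \<Longrightarrow> f s \<le> f t"
  by (auto simp: counting_path_def mono_on_def)

lemma left_lim_eqI:
  assumes "0 \<le> s" "s < t" "\<And>r. s \<le> r \<Longrightarrow> r < t \<Longrightarrow> f r = c"
  shows "left_lim f t = c"
proof -
  have "eventually (\<lambda>r. f r = c) (at_left t)"
    using eventually_at_left_real[OF assms(2)] by eventually_elim (auto intro: assms(3))
  then have "(f \<longlongrightarrow> c) (at_left t)"
    by (rule tendsto_eventually)
  then show ?thesis
    using assms(1,2) by (simp add: left_lim_def tendsto_Lim trivial_limit_at_left_real)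
qed

lemma counting_path_no_jump:
  assumes "counting_path f" "0 \<le> s" "f t = f s" "u \<in> {s<..t}"
  shows "\<not> jump_time f u" and "left_lim f u = f u"
proof -
  have "f r = f s" if "s \<le> r" "r \<le> t" for r
    using counting_path_mono[OF assms(1), of s r] counting_path_mono[OF assms(1), of r t] assms that
    by simp
  note const = this
  show "left_lim f u = f u"
    by (rule left_lim_eqI[of s]) (use assms(2,4) const[of u] in \<open>auto intro: const\<close>)
  then show "\<not> jump_time f u"
    by (simp add: jump_time_def)
qed

lemma counting_path_jump:
  assumes f: "counting_path f" and "0 \<le> s" "s \<le> t" "f t = Suc (f s)"
  obtains u where "s < u" "u \<le> t" "\<And>r. s \<le> r \<Longrightarrow> r < u \<Longrightarrow> f r = f s"
    "\<And>r. u \<le> r \<Longrightarrow> r \<le> t \<Longrightarrow> f r = Suc (f s)"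
proof -
  define X where "X = {r\<in>{s..t}. f r \<noteq> f s}"
  define u where "u = Inf X"
  have "t \<in> X" using assms by (simp add: X_def)
  have bdd: "bdd_below X" by (auto simp: X_def intro: bdd_belowI[of _ s])
  have su: "s \<le> u" "u \<le> t"
  proof -
    show "s \<le> u" unfolding u_def by (rule cInf_greatest) (use \<open>t \<in> X\<close> in \<open>auto simp: X_def\<close>)
    show "u \<le> t" unfolding u_def by (rule cInf_lower) (use \<open>t \<in> X\<close> bdd in auto)
  qed
  have mono: "f r \<le> f r'" if "s \<le> r" "r \<le> r'" for r r'
    using counting_path_mono[OF f] assms(2) that by simp
  \<comment> \<open>Right continuity into a discrete space makes \<open>f\<close> constant just
    after \<open>u\<close>, so the infimum itself already carries the new value.\<close>
  have fu: "f u \<noteq> f s"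
  proof
    assume eq: "f u = f s"
    have "(f \<longlongrightarrow> f u) (at_right u)"
      using f su assms(2) by (auto simp: counting_path_def continuous_within)
    then have "eventually (\<lambda>r. f r = f u) (at_right u)"
      by (simp add: tendsto_discrete)
    then obtain b where b: "b > u" "\<And>r. u < r \<Longrightarrow> r < b \<Longrightarrow> f r = f u"
      by (auto simp: eventually_at_right_field)
    have "X \<noteq> {}" using \<open>t \<in> X\<close> by auto
    then obtain x where "x \<in> X" "x < b"
      using b(1) cInf_lessD[of X b] unfolding u_def by blast
    moreover have "u \<le> x" using \<open>x \<in> X\<close> bdd by (simp add: u_def cInf_lower)
    ultimately show False using b(2)[of x] eq by (cases "x = u") (auto simp: X_def)
  qed
  show ?thesis
  proof
    show "s < u" using fu su by (cases "u = s") auto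
    show "u \<le> t" by fact
    show "f r = f s" if "s \<le> r" "r < u" for r
    proof (rule ccontr)
      assume "f r \<noteq> f s"
      then have "r \<in> X" using that su by (auto simp: X_def)
      then have "u \<le> r" unfolding u_def using bdd by (rule cInf_lower)
      then show False using that by simp
    qed
    show "f r = Suc (f s)" if "u \<le> r" "r \<le> t" for r
      using mono[of u r] mono[of r t] mono[of s u] fu su that assms(4) by linarith
  qed
qed

lemma meteor_path_unchanged:
  assumes M: "meteor_path V E N M" and "x \<in> V" "0 \<le> s" "s \<le> t"
    and N: "\<And>y. y \<in> insert x (neighbors V E x) \<Longrightarrow> counting_path (N y) \<and> N y t = N y s"
  shows "M x t = M x s"
proof (cases "s = t")
  case False
  then have "s < t" using assms by simp
  moreover have "\<not> jump_time (N y) u" if "y \<in> insert x (neighbors V E x)" "u \<in> {s<..t}" for y u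
    using N[OF that(1)] counting_path_no_jump(1)[of "N y" s t u] that assms by auto
  ultimately show ?thesis
    using M assms(2,3) unfolding meteor_path_def by blast
qed auto

text \<open>The path rules speak of jump instants; this turns them into a relation between the
  values at \<open>s\<close> and \<open>t\<close>, so that later only counts at grid times matter. A
  neighbor \<open>x\<close> of \<open>v\<close> receives nothing else because its other neighbors
  are silent too. Line and circle share this lemma.\<close>

lemma meteor_path_jump:
  assumes M: "meteor_path V E N M" and v: "v \<in> V" "\<not> E v v" and s: "0 \<le> s" "s \<le> t"
    and N: "\<And>y. y \<in> V \<Longrightarrow> counting_path (N y)"
    and Nv: "N v t = Suc (N v s)"
    and Ny: "\<And>y. y \<in> neighbors V E v \<Longrightarrow> N y t = N y s"
  obtains u where "s < u" "u \<le> t" "N v u = Suc (N v s)" "left_lim (N v) u = N v s"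
    "\<And>r. r \<in> {s<..t} \<Longrightarrow> r \<noteq> u \<Longrightarrow> left_lim (N v) r = N v r"
    "left_lim (M v) u = M v s" "M v t = 0"
    "\<And>x. \<lbrakk>x \<in> neighbors V E v; \<And>y. y \<in> neighbors V E x \<Longrightarrow> y \<noteq> v \<Longrightarrow> N y t = N y s\<rbrakk>
       \<Longrightarrow> M x t = M x s + M v s / real (card (neighbors V E v))"
proof -
  obtain u where u: "s < u" "u \<le> t" and before: "\<And>r. s \<le> r \<Longrightarrow> r < u \<Longrightarrow> N v r = N v s"
    and after: "\<And>r. u \<le> r \<Longrightarrow> r \<le> t \<Longrightarrow> N v r = Suc (N v s)"
    using counting_path_jump[OF N[OF v(1)] s Nv] by metis
  have const: "N y r = N y s" if "y \<in> V" "N y t = N y s" "s \<le> r" "r \<le> t" for y r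
  proof -
    have "N y s \<le> N y r" "N y r \<le> N y t"
      using counting_path_mono[OF N[OF that(1)], of s r] counting_path_mono[OF N[OF that(1)], of r t]
        s that by auto
    then show ?thesis using that by simp
  qed
  have left: "left_lim (N v) u = N v s"
    by (rule left_lim_eqI[OF s(1) u(1) before])
  have jump: "jump_time (N v) u"
    using left after[of u] u by (simp add: jump_time_def)
  have nbrs: "neighbors V E x \<subseteq> V" for x by (auto simp: neighbors_def)
  \<comment> \<open>The condition \<open>r' < u \<or> u \<le> r\<close> says that the half-open
    interval from \<open>r\<close> to \<open>r'\<close> misses the only jump of
    \<open>v\<close>.\<close>
  have unchanged: "M x r' = M x r"
    if x: "x \<in> V" "\<And>y. y \<in> insert x (neighbors V E x) \<Longrightarrow> y \<noteq> v \<Longrightarrow> N y t = N y s"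
      and r: "s \<le> r" "r \<le> r'" "r' \<le> t" "r' < u \<or> u \<le> r" for x r r'
  proof (rule meteor_path_unchanged[OF M x(1)])
    fix y assume y: "y \<in> insert x (neighbors V E x)"
    then have "y \<in> V" using x(1) nbrs by blast
    show "counting_path (N y) \<and> N y r' = N y r"
    proof (cases "y = v")
      case True
      have "N v r' = N v r"
        using r before[of r] before[of r'] after[of r] after[of r'] by linarith
      then show ?thesis using True N[OF v(1)] by simp
    next
      case False
      then show ?thesis using const[OF \<open>y \<in> V\<close> x(2)[OF y False], of r] const[OF \<open>y \<in> V\<close> x(2)[OF y False], of r']
          N[OF \<open>y \<in> V\<close>] r by simp
    qed
  qed (use r(1-3) s in simp_all)
  have left_M: "left_lim (M x) u = M x s"
    if "x \<in> V" and y: "\<And>y. y \<in> insert x (neighbors V E x) \<Longrightarrow> y \<noteq> v \<Longrightarrow> N y t = N y s" for x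
  proof (rule left_lim_eqI[of s])
    show "M x r = M x s" if "s \<le> r" "r < u" for r
      by (rule unchanged[OF \<open>x \<in> V\<close> y]) (use that u in auto)
  qed (use u s in auto)
  have jump_rule: "M v u = 0"
    "\<And>x. x \<in> neighbors V E v \<Longrightarrow> M x u = left_lim (M x) u + left_lim (M v) u / real (card (neighbors V E v))"
  proof -
    have "0 < u" using s u by simp
    with M v(1) jump have "M v u = 0 \<and> (\<forall>x\<in>neighbors V E v.
        M x u = left_lim (M x) u + left_lim (M v) u / real (card (neighbors V E v)))"
      unfolding meteor_path_def by blast
    then show "M v u = 0"
      "\<And>x. x \<in> neighbors V E v \<Longrightarrow> M x u = left_lim (M x) u + left_lim (M v) u / real (card (neighbors V E v))"
      by blast+
  qed
  have Mv: "left_lim (M v) u = M v s" "M v t = M v u"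
  proof -
    have y: "N y t = N y s" if "y \<in> insert v (neighbors V E v)" "y \<noteq> v" for y
      using that Ny by (metis insert_iff)
    show "left_lim (M v) u = M v s" by (rule left_M[OF v(1) y])
    show "M v t = M v u" by (rule unchanged[OF v(1) y]) (use u in auto)
  qed
  show ?thesis
  proof
    show "left_lim (N v) r = N v r" if "r \<in> {s<..t}" "r \<noteq> u" for r
    proof (cases "r < u")
      case True
      then have "left_lim (N v) r = N v s"
        by (intro left_lim_eqI[of s] before) (use that s in auto)
      then show ?thesis using before[of r] that True by simp
    next
      case False
      then have "left_lim (N v) r = Suc (N v s)"
        by (intro left_lim_eqI[of u] after) (use that s u in auto)
      then show ?thesis using after[of r] that False by simp
    qed
    show "M x t = M x s + M v s / real (card (neighbors V E v))"
      if x: "x \<in> neighbors V E v" and y: "\<And>y. y \<in> neighbors V E x \<Longrightarrow> y \<noteq> v \<Longrightarrow> N y t = N y s" for x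
    proof -
      have cond: "x \<in> V" "\<And>y. y \<in> insert x (neighbors V E x) \<Longrightarrow> y \<noteq> v \<Longrightarrow> N y t = N y s"
        using x nbrs y Ny[OF x] by (blast, metis insert_iff)
      have "M x t = M x u" by (rule unchanged[OF cond]) (use u in auto)
      then show ?thesis using jump_rule(2)[OF x] left_M[OF cond] Mv by simp
    qed
  qed (use u after[of u] left jump_rule(1) Mv in simp_all)
qed

section \<open>The dual chain of flow coefficients\<close>

text \<open>The chain lives on \<open>{-L..L}\<close>. Edges leaving this interval count as zero (lazy reflection at
  \<open>-L\<close> and \<open>L\<close>), so that the drifts still sum to zero; this changes nothing as long as the
  coefficients vanish near the ends.\<close>

definition flow_edge :: "int \<Rightarrow> (int \<Rightarrow> real) \<Rightarrow> int \<Rightarrow> real" where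
  "flow_edge L \<phi> x = (if - L \<le> x \<and> x < L then \<phi> (x + 1) - \<phi> x + (if x = 0 then 1 else 0) else 0)"

definition flow_drift :: "int \<Rightarrow> (int \<Rightarrow> real) \<Rightarrow> int \<Rightarrow> real" where
  "flow_drift L \<phi> v = (flow_edge L \<phi> v - flow_edge L \<phi> (v - 1)) / 2"

definition flow_update :: "int \<Rightarrow> (int \<Rightarrow> real) \<Rightarrow> int option \<Rightarrow> int \<Rightarrow> real" where
  "flow_update L \<phi> a = (case a of None \<Rightarrow> \<phi> | Some v \<Rightarrow> \<phi>(v := \<phi> v + flow_drift L \<phi> v))"

text \<open>An entry \<^term>\<open>Some v\<close> is a jump of \<open>v\<close>, \<^const>\<open>None\<close> a time step without jump; the head of the list is
  the earliest step, so the chain runs backwards in time.\<close>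

primrec flow_coeff :: "int \<Rightarrow> int option list \<Rightarrow> int \<Rightarrow> real" where
  "flow_coeff L [] = (\<lambda>_. 0)"
| "flow_coeff L (a # as) = flow_update L (flow_coeff L as) a"

text \<open>With the plain gradient in place of \<open>flow_edge\<close> this is the second moment
  of the masses weighted by \<open>\<phi>\<close>.\<close>

definition flow_energy :: "int \<Rightarrow> (int \<Rightarrow> real) \<Rightarrow> real" where
  "flow_energy L \<phi> = (\<Sum>x\<in>{-L..<L}. (flow_edge L \<phi> x)\<^sup>2) / 2 + (\<Sum>x\<in>{-L..L}. \<phi> x)\<^sup>2"

text \<open>The drift is half a discrete divergence, so its sum telescopes; the boundary terms at
  \<open>-L - 1\<close> and \<open>L\<close> vanish because \<open>flow_edge\<close> is cut off
  there.\<close>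

lemma sum_flow_drift: "(\<Sum>v\<in>{-L..L}. flow_drift L \<phi> v) = 0"
proof -
  have "(\<Sum>v\<in>{-L..L}. flow_edge L \<phi> (v - 1)) = (\<Sum>v\<in>{-L-1..L-1}. flow_edge L \<phi> v)"
    by (rule sum.reindex_bij_witness[of _ "\<lambda>v. v + 1" "\<lambda>v. v - 1"]) auto
  also have "\<dots> = (\<Sum>v\<in>{-L..<L}. flow_edge L \<phi> v)"
    by (rule sum.mono_neutral_right) (auto simp: flow_edge_def)
  also have "\<dots> = (\<Sum>v\<in>{-L..L}. flow_edge L \<phi> v)"
    by (rule sum.mono_neutral_left) (auto simp: flow_edge_def)
  finally show ?thesis
    by (simp add: flow_drift_def sum_subtractf flip: sum_divide_distrib)
qed

text \<open>If \<open>D\<close> is the drift at \<open>v\<close>, then \<open>e v\<close> falls by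
  \<open>D\<close> and \<open>e (v - 1)\<close> rises by \<open>D\<close>. As
  \<open>2 * D = e v - e (v - 1)\<close>, half the sum of squares falls by \<open>D\<^sup>2\<close>,
  which cancels the \<open>D\<^sup>2\<close> in the expansion of the squared total. At an end of the
  window one of the two edges is missing and the sum of squares falls by
  \<open>3 * D\<^sup>2\<close> instead of \<open>2 * D\<^sup>2\<close>, hence only an
  inequality.\<close>

lemma flow_energy_update:
  assumes v: "v \<in> {-L..L}"
  shows "flow_energy L (flow_update L \<phi> (Some v)) - flow_energy L \<phi>
    \<le> 2 * (\<Sum>x\<in>{-L..L}. \<phi> x) * flow_drift L \<phi> v"
proof -
  define e where "e = flow_edge L \<phi>"
  define D where "D = flow_drift L \<phi> v"
  define S where "S = (\<Sum>x\<in>{-L..L}. \<phi> x)"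
  define \<psi> where "\<psi> = flow_update L \<phi> (Some v)"
  have \<psi>: "\<psi> x = \<phi> x + (if x = v then D else 0)" for x
    by (simp add: \<psi>_def flow_update_def D_def)
  have S: "(\<Sum>x\<in>{-L..L}. \<psi> x) = S + D"
    using v by (simp add: \<psi> sum.distrib S_def)
  have "(flow_edge L \<psi> x)\<^sup>2 = (e x)\<^sup>2 + ((if x = v then (e v - D)\<^sup>2 - (e v)\<^sup>2 else 0)
      + (if x = v - 1 then (e (v - 1) + D)\<^sup>2 - (e (v - 1))\<^sup>2 else 0))" if "x \<in> {-L..<L}" for x
    using that by (auto simp: flow_edge_def \<psi> e_def algebra_simps)
  then have "(\<Sum>x\<in>{-L..<L}. (flow_edge L \<psi> x)\<^sup>2) - (\<Sum>x\<in>{-L..<L}. (e x)\<^sup>2)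
      = (if v \<in> {-L..<L} then (e v - D)\<^sup>2 - (e v)\<^sup>2 else 0)
      + (if v - 1 \<in> {-L..<L} then (e (v - 1) + D)\<^sup>2 - (e (v - 1))\<^sup>2 else 0)"
    by (simp add: sum.distrib)
  moreover have "\<dots> \<le> - 2 * D\<^sup>2"
  proof -
    have D: "2 * D = e v - e (v - 1)"
      by (simp add: D_def flow_drift_def e_def)
    have out: "v \<notin> {-L..<L} \<Longrightarrow> e v = 0" "v - 1 \<notin> {-L..<L} \<Longrightarrow> e (v - 1) = 0"
      by (auto simp: e_def flow_edge_def)
    have both: "(p - d)\<^sup>2 - p\<^sup>2 + ((q + d)\<^sup>2 - q\<^sup>2) = - 2 * d\<^sup>2" if "2 * d = p - q" for p q d :: real
    proof -
      have "p = 2 * d + q" using that by simp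
      then show ?thesis by (simp add: power2_eq_square algebra_simps)
    qed
    have fst: "(p - d)\<^sup>2 - p\<^sup>2 \<le> - 2 * d\<^sup>2" if "2 * d = p - 0" for p d :: real
    proof -
      have "p = 2 * d" using that by simp
      then show ?thesis by (simp add: power2_eq_square)
    qed
    have snd: "(q + d)\<^sup>2 - q\<^sup>2 \<le> - 2 * d\<^sup>2" if "2 * d = 0 - q" for q d :: real
    proof -
      have "q = - (2 * d)" using that by simp
      then show ?thesis by (simp add: power2_eq_square)
    qed
    consider "v \<in> {-L..<L}" "v - 1 \<in> {-L..<L}" | "v \<in> {-L..<L}" "v - 1 \<notin> {-L..<L}"
      | "v \<notin> {-L..<L}" "v - 1 \<in> {-L..<L}" | "v \<notin> {-L..<L}" "v - 1 \<notin> {-L..<L}"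
      by blast
    then show ?thesis
    proof cases
      case 1
      then show ?thesis using both[OF D] by simp
    next
      case 2
      then show ?thesis using fst[of D "e v"] D out(2) by simp
    next
      case 3
      then show ?thesis using snd[of D "e (v - 1)"] D out(1) by simp
    next
      case 4
      then show ?thesis using D out by simp
    qed
  qed
  ultimately have "(\<Sum>x\<in>{-L..<L}. (flow_edge L \<psi> x)\<^sup>2) - (\<Sum>x\<in>{-L..<L}. (e x)\<^sup>2) \<le> - 2 * D\<^sup>2"
    by linarith
  then show ?thesis
    unfolding flow_energy_def \<psi>_def[symmetric] S S_def[symmetric] D_def[symmetric] e_def[symmetric]
    by (simp add: power2_eq_square algebra_simps)
qed

text \<open>Here \<open>w0\<close> is the weight of a silent step and \<open>w1\<close> that of a
  jump of one given site. The total may stay below one, since steps with several jumps are dropped.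
  The terms linear in the drift sum to zero.\<close>

lemma sum_flow_energy_update:
  assumes "0 \<le> w1" "w0 + real (card {-L..L}) * w1 \<le> 1"
  shows "(\<Sum>a\<in>insert None (Some ` {-L..L}). (case a of None \<Rightarrow> w0 | Some _ \<Rightarrow> w1)
      * flow_energy L (flow_update L \<phi> a)) \<le> flow_energy L \<phi>"
proof -
  let ?E = "flow_energy L" and ?S = "\<Sum>x\<in>{-L..L}. \<phi> x"
  have "(\<Sum>a\<in>insert None (Some ` {-L..L}). (case a of None \<Rightarrow> w0 | Some _ \<Rightarrow> w1)
      * ?E (flow_update L \<phi> a)) =
      w0 * ?E \<phi> + (\<Sum>v\<in>{-L..L}. w1 * ?E (flow_update L \<phi> (Some v)))"
    by (simp add: sum.reindex flow_update_def)
  also have "\<dots> \<le> w0 * ?E \<phi> + (\<Sum>v\<in>{-L..L}. w1 * (?E \<phi> + 2 * ?S * flow_drift L \<phi> v))"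
    using flow_energy_update[of _ L \<phi>]
    by (intro add_left_mono sum_mono mult_left_mono assms) (simp add: algebra_simps)
  also have "\<dots> = (w0 + real (card {-L..L}) * w1) * ?E \<phi> + w1 * (2 * ?S) * (\<Sum>v\<in>{-L..L}. flow_drift L \<phi> v)"
  proof -
    have "(\<Sum>v\<in>{-L..L}. w1 * (c + d * f v)) = real (card {-L..L}) * w1 * c + w1 * d * (\<Sum>v\<in>{-L..L}. f v)"
      for c d :: real and f
      by (simp add: distrib_left sum.distrib sum_distrib_left mult.assoc)
    then show ?thesis by (simp only: distrib_right add.assoc)
  qed
  also have "\<dots> \<le> 1 * ?E \<phi>"
    unfolding sum_flow_drift
    using mult_right_mono[OF assms(2), of "?E \<phi>"] by (simp add: flow_energy_def sum_nonneg)
  finally show ?thesis by simp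
qed

lemma sum_lists_length_Suc:
  assumes "finite A"
  shows "(\<Sum>as\<in>{as. set as \<subseteq> A \<and> length as = Suc m}. f as)
    = (\<Sum>as\<in>{as. set as \<subseteq> A \<and> length as = m}. \<Sum>a\<in>A. f (a # as))"
  unfolding lists_length_Suc_eq
  by (subst sum.reindex) (auto simp: inj_on_def sum.cartesian_product split_def)

context
  fixes L :: int and w0 w1 :: real
  assumes w: "0 \<le> w0" "0 \<le> w1" "w0 + real (card {-L..L}) * w1 \<le> 1"
begin

lemma sum_lists_weight:
  "(\<Sum>as\<in>{as. set as \<subseteq> insert None (Some ` {-L..L}) \<and> length as = m}.
      \<Prod>a\<leftarrow>as. case a of None \<Rightarrow> w0 | Some _ \<Rightarrow> w1) = (w0 + real (card {-L..L}) * w1) ^ m"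
proof (induction m)
  case (Suc m)
  have "(\<Sum>a\<in>insert None (Some ` {-L..L}). case a of None \<Rightarrow> w0 | Some _ \<Rightarrow> w1)
      = w0 + real (card {-L..L}) * w1"
    by (simp add: sum.reindex)
  then show ?case
    by (simp add: sum_lists_length_Suc Suc.IH del: sum.insert flip: sum_distrib_left sum_distrib_right)
qed (simp cong: conj_cong)

text \<open>The head of the list is the update that the chain applies last, so averaging over it
  first reduces the length by one. The value \<open>1 / 2\<close> is the energy of the zero
  coefficients, for which only the source edge 0 contributes.\<close>

lemma sum_lists_flow_energy:
  "(\<Sum>as\<in>{as. set as \<subseteq> insert None (Some ` {-L..L}) \<and> length as = m}.
      (\<Prod>a\<leftarrow>as. case a of None \<Rightarrow> w0 | Some _ \<Rightarrow> w1) * flow_energy L (flow_coeff L as)) \<le> 1 / 2"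
proof (induction m)
  case 0
  have "{as. set as \<subseteq> insert None (Some ` {-L..L}) \<and> length as = 0} = {[]}" by auto
  moreover have "(\<Sum>x\<in>{-L..<L}. (flow_edge L (\<lambda>_. 0) x)\<^sup>2) \<le> (\<Sum>x\<in>{-L..<L}. if x = 0 then 1 else 0)"
    by (rule sum_mono) (auto simp: flow_edge_def)
  then have "flow_energy L (\<lambda>_. 0) \<le> 1 / 2"
    by (simp add: flow_energy_def split: if_splits)
  ultimately show ?case by simp
next
  case (Suc m)
  let ?A = "insert None (Some ` {-L..L})" and ?w = "\<lambda>a. case a of None \<Rightarrow> w0 | Some _ \<Rightarrow> w1"
  have "(\<Sum>as\<in>{as. set as \<subseteq> ?A \<and> length as = Suc m}. (\<Prod>a\<leftarrow>as. ?w a) * flow_energy L (flow_coeff L as))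
     = (\<Sum>as\<in>{as. set as \<subseteq> ?A \<and> length as = m}. (\<Prod>a\<leftarrow>as. ?w a) *
          (\<Sum>a\<in>?A. ?w a * flow_energy L (flow_update L (flow_coeff L as) a)))"
    by (subst sum_lists_length_Suc) (simp_all add: sum_distrib_left mult_ac del: sum.insert)
  also have "\<dots> \<le> (\<Sum>as\<in>{as. set as \<subseteq> ?A \<and> length as = m}. (\<Prod>a\<leftarrow>as. ?w a) * flow_energy L (flow_coeff L as))"
    using w by (intro sum_mono mult_left_mono sum_flow_energy_update prod_list_nonneg)
      (auto split: option.split)
  finally show ?case using Suc by simp
qed

end

lemma gradient_le_flow_energy:
  "(\<Sum>x\<in>{-L..<L}. (\<phi> (x + 1) - \<phi> x)\<^sup>2) / 2 + (\<Sum>x\<in>{-L..L}. \<phi> x)\<^sup>2 \<le> 2 * flow_energy L \<phi> + 1"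
proof -
  have "(\<Sum>x\<in>{-L..<L}. (\<phi> (x + 1) - \<phi> x)\<^sup>2)
      \<le> (\<Sum>x\<in>{-L..<L}. 2 * (flow_edge L \<phi> x)\<^sup>2 + (if x = 0 then 2 else 0))"
  proof (rule sum_mono)
    fix x assume "x \<in> {-L..<L}"
    \<comment> \<open>The difference of the two sides is \<open>(a - b + 2)\<^sup>2\<close>.\<close>
    moreover have "(a - b)\<^sup>2 \<le> 2 * (a - b + 1)\<^sup>2 + 2" for a b :: real
      using zero_le_power2[of "a - b + 2"] by (simp add: power2_eq_square algebra_simps)
    ultimately show "(\<phi> (x + 1) - \<phi> x)\<^sup>2 \<le> 2 * (flow_edge L \<phi> x)\<^sup>2 + (if x = 0 then 2 else 0)"
      by (auto simp: flow_edge_def)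
  qed
  also have "\<dots> \<le> 2 * (\<Sum>x\<in>{-L..<L}. (flow_edge L \<phi> x)\<^sup>2) + 2"
    by (simp add: sum.distrib sum_distrib_left)
  finally have "(\<Sum>x\<in>{-L..<L}. (\<phi> (x + 1) - \<phi> x)\<^sup>2) / 2 \<le> (\<Sum>x\<in>{-L..<L}. (flow_edge L \<phi> x)\<^sup>2) + 1"
    by simp
  moreover have "(\<Sum>x\<in>{-L..L}. \<phi> x)\<^sup>2 \<le> 2 * (\<Sum>x\<in>{-L..L}. \<phi> x)\<^sup>2"
    by simp
  ultimately show ?thesis
    unfolding flow_energy_def distrib_left by linarith
qed

text \<open>The sites \<open>a\<close> and \<open>b\<close> never jump, so their coefficients stay
  at the initial value zero. The source acts only on 0 and 1, strictly between them, and a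
  nearest-neighbor update cannot carry anything across a zero that is never updated.\<close>

lemma flow_coeff_outside:
  assumes "Some a \<notin> set as" "Some b \<notin> set as" "a < 0" "1 < b" "x \<notin> {a<..<b}"
  shows "flow_coeff L as x = 0"
  using assms(1,2,5)
proof (induction as arbitrary: x)
  case (Cons c as)
  then have IH: "flow_coeff L as y = 0" if "y \<notin> {a<..<b}" for y
    using that by simp
  show ?case
  proof (cases "c = Some x")
    case True
    then have "x < a \<or> b < x" using Cons.prems by auto
    then have "flow_drift L (flow_coeff L as) x = 0"
      using assms(3,4) by (auto simp: flow_drift_def flow_edge_def IH)
    then show ?thesis using True IH Cons.prems by (simp add: flow_update_def)
  next
    case False
    then show ?thesis using IH Cons.prems by (auto simp: flow_update_def split: option.split)
  qed
qed simp

section \<open>The flow is linear in the initial masses\<close>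

definition flow_term :: "(int \<Rightarrow> real \<Rightarrow> nat) \<Rightarrow> (int \<Rightarrow> real \<Rightarrow> real) \<Rightarrow> real \<Rightarrow> real" where
  "flow_term N M s = (real (N 0 s) - real (left_lim (N 0) s)) * left_lim (M 0) s
     - (real (N 1 s) - real (left_lim (N 1) s)) * left_lim (M 1) s"

lemma neighbors_int_adj: "neighbors UNIV int_adj x = {x - 1, x + 1}"
  by (auto simp: neighbors_def int_adj_def)

text \<open>Duality over one grid cell: a jump of \<open>v\<close> sends half of its mass to each
  neighbor, so in the pairing with \<open>\<phi>\<close> the coefficient of \<open>M v s\<close>
  becomes the average of the neighboring coefficients, while the source accounts for the flow
  through the edge. A jump beyond \<open>a\<close> or \<open>b\<close> leaves the masses strictly
  between them alone. The factor 2 undoes the \<open>1/2\<close> of \<open>net_flow\<close>, which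
  \<open>flow_term\<close> omits.\<close>

lemma flow_cell:
  fixes L a b :: int
  assumes M: "meteor_path UNIV int_adj N M" and N: "\<And>v. counting_path (N v)"
    and s: "0 \<le> s" "s \<le> t"
    and ab: "- L \<le> a" "a < 0" "1 < b" "b \<le> L" "c \<noteq> Some a" "c \<noteq> Some b"
    and c: "\<And>v. v \<in> {-L..L} \<Longrightarrow> N v t = N v s + (if c = Some v then 1 else 0)"
    and \<phi>: "\<And>x. x \<notin> {a<..<b} \<Longrightarrow> \<phi> x = 0"
  shows "(flow_term N M has_sum
      2 * ((\<Sum>x\<in>{a<..<b}. flow_update L \<phi> c x * M x s) - (\<Sum>x\<in>{a<..<b}. \<phi> x * M x t))) {s<..t}"
proof -
  have still: "left_lim (N v) r = N v r" if "v \<in> {-L..L}" "c \<noteq> Some v" "r \<in> {s<..t}" for v r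
    by (rule counting_path_no_jump(2)[OF N s(1) _ that(3)]) (use c[OF that(1)] that(2) in simp)
  have far: "M x t = M x s" if "x \<in> {a<..<b}" "c \<notin> {Some (x - 1), Some x, Some (x + 1)}" for x
    by (rule meteor_path_unchanged[OF M UNIV_I s])
      (use N c that ab in \<open>auto simp: neighbors_int_adj\<close>)
  show ?thesis
  proof (cases "\<exists>v\<in>{a<..<b}. c = Some v")
    case False
    have "(flow_term N M has_sum 0) {s<..t}"
      using False ab by (intro has_sum_0) (auto simp: flow_term_def still)
    moreover have "M x t = M x s" if "x \<in> {a<..<b}" for x
    proof (rule far[OF that])
      show "c \<notin> {Some (x - 1), Some x, Some (x + 1)}"
        using False ab that by (cases c) auto
    qed
    moreover have "flow_update L \<phi> c x = \<phi> x" if "x \<in> {a<..<b}" for x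
      using False that by (auto simp: flow_update_def split: option.split)
    ultimately show ?thesis by simp
  next
    case True
    then obtain v where v: "v \<in> {a<..<b}" "c = Some v" by auto
    have vL: "v \<in> {-L..L}" "v - 1 \<in> {-L..L}" "v + 1 \<in> {-L..L}" using v ab by auto
    have Nv: "N v t = Suc (N v s)" using c[OF vL(1)] v by simp
    have Ny: "N y t = N y s" if "y \<in> neighbors UNIV int_adj v" for y
      using that c[OF vL(2)] c[OF vL(3)] v by (auto simp: neighbors_int_adj)
    obtain u where u: "s < u" "u \<le> t" "N v u = Suc (N v s)" "left_lim (N v) u = N v s"
      and stillv: "\<And>r. r \<in> {s<..t} \<Longrightarrow> r \<noteq> u \<Longrightarrow> left_lim (N v) r = N v r"
      and Mv: "left_lim (M v) u = M v s" "M v t = 0"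
      and nbr: "\<And>x. \<lbrakk>x \<in> neighbors UNIV int_adj v;
           \<And>y. y \<in> neighbors UNIV int_adj x \<Longrightarrow> y \<noteq> v \<Longrightarrow> N y t = N y s\<rbrakk>
         \<Longrightarrow> M x t = M x s + M v s / real (card (neighbors UNIV int_adj v))"
      using meteor_path_jump[OF M UNIV_I _ s N Nv Ny] by (auto simp: int_adj_def)
    \<comment> \<open>Mass leaving 0 counts positively and mass leaving 1 negatively;
      \<open>\<delta> / 2\<close> is exactly the source part of \<open>flow_drift\<close>.\<close>
    define \<delta> :: real where "\<delta> = (if v = 0 then 1 else 0) - (if v = 1 then 1 else 0)"
    have flow: "(flow_term N M has_sum \<delta> * M v s) {s<..t}"
    proof (rule has_sum_finite_neutralI[of "{u}"])
      show "flow_term N M r = 0" if "r \<in> {s<..t} - {u}" for r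
      proof -
        have "left_lim (N w) r = N w r" if "w \<in> {0, 1}" for w
          using still[of w r] stillv[of r] that \<open>r \<in> {s<..t} - {u}\<close> v ab by (cases "w = v") auto
        then show ?thesis by (simp add: flow_term_def)
      qed
      have "left_lim (N w) u = N w u" if "w \<in> {0, 1}" "w \<noteq> v" for w
        using still[of w u] that v ab u by auto
      then show "\<delta> * M v s = sum (flow_term N M) {u}"
        using u Mv by (auto simp: flow_term_def \<delta>_def)
    qed (use u in auto)
    have Mx: "M x t = M x s + (if x = v then - M v s else 0) + (if x = v - 1 then M v s / 2 else 0)
        + (if x = v + 1 then M v s / 2 else 0)" if x: "x \<in> {a<..<b}" for x
    proof -
      have "M x t = M x s + M v s / 2" if "x \<in> {v - 1, v + 1}"
      proof -
        have "N y t = N y s" if "y \<in> neighbors UNIV int_adj x" "y \<noteq> v" for y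
          using c[of y] that x ab v by (auto simp: neighbors_int_adj)
        then show ?thesis using nbr[of x] that by (auto simp: neighbors_int_adj)
      qed
      moreover have "M x t = M x s" if "x \<notin> {v - 1, v, v + 1}"
        by (rule far[OF x]) (use that v in auto)
      ultimately show ?thesis using Mv(2) by auto
    qed
    have pick: "(\<Sum>x\<in>{a<..<b}. \<phi> x * (if x = w then z else 0)) = \<phi> w * z" for w z
      using \<phi>[of w] by (simp add: if_distrib[of "\<lambda>y. _ * y"] cong: if_cong)
    have "(\<Sum>x\<in>{a<..<b}. \<phi> x * M x t) = (\<Sum>x\<in>{a<..<b}. \<phi> x * M x s + \<phi> x * (if x = v then - M v s else 0)
        + \<phi> x * (if x = v - 1 then M v s / 2 else 0) + \<phi> x * (if x = v + 1 then M v s / 2 else 0))"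
      by (rule sum.cong[OF refl]) (simp only: Mx distrib_left)
    also have "\<dots> = (\<Sum>x\<in>{a<..<b}. \<phi> x * M x s) + (\<phi> (v - 1) / 2 + \<phi> (v + 1) / 2 - \<phi> v) * M v s"
      by (simp only: sum.distrib pick) (simp add: algebra_simps)
    finally have after: "(\<Sum>x\<in>{a<..<b}. \<phi> x * M x t) = \<dots>" .
    have "(\<Sum>x\<in>{a<..<b}. flow_update L \<phi> c x * M x s)
        = (\<Sum>x\<in>{a<..<b}. \<phi> x * M x s + (if x = v then flow_drift L \<phi> v * M v s else 0))"
      using v by (intro sum.cong) (auto simp: flow_update_def algebra_simps)
    also have "\<dots> = (\<Sum>x\<in>{a<..<b}. \<phi> x * M x s) + flow_drift L \<phi> v * M v s"
      using v by (simp add: sum.distrib)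
    also have "flow_drift L \<phi> v = (\<phi> (v - 1) / 2 + \<phi> (v + 1) / 2 - \<phi> v)
        + \<delta> / 2"
      using v ab by (simp add: \<delta>_def flow_drift_def flow_edge_def field_simps)
    finally show ?thesis
      using flow unfolding after by (simp add: algebra_simps)
  qed
qed

text \<open>The identities of the single cells telescope. Nothing is left at the final time, because
  the coefficients of the empty list are zero.\<close>

lemma flow_linear:
  fixes L a b :: int and \<tau> :: "nat \<Rightarrow> real"
  assumes M: "meteor_path UNIV int_adj N M" and N: "\<And>v. counting_path (N v)"
    and \<tau>: "0 \<le> \<tau> 0" "\<And>i. \<tau> i \<le> \<tau> (Suc i)"
    and ab: "- L \<le> a" "a < 0" "1 < b" "b \<le> L" "Some a \<notin> set as" "Some b \<notin> set as"
    and c: "\<And>v i. v \<in> {-L..L} \<Longrightarrow> i < length as \<Longrightarrow>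
      N v (\<tau> (Suc i)) = N v (\<tau> i) + (if as ! i = Some v then 1 else 0)"
  shows "(flow_term N M has_sum 2 * (\<Sum>x\<in>{a<..<b}. flow_coeff L as x * M x (\<tau> 0))) {\<tau> 0<..\<tau> (length as)}"
  using \<tau> ab(5,6) c
proof (induction as arbitrary: \<tau>)
  case (Cons c as)
  have mono: "\<tau> 1 \<le> \<tau> n" if "1 \<le> n" for n
    using that by (induction n rule: dec_induct) (auto intro: order_trans Cons.prems(2))
  have "(flow_term N M has_sum 2 * (\<Sum>x\<in>{a<..<b}. flow_coeff L as x * M x (\<tau> (Suc 0))))
      {\<tau> (Suc 0)<..\<tau> (Suc (length as))}"
  proof (rule Cons.IH)
    show "N v (\<tau> (Suc (Suc i))) = N v (\<tau> (Suc i)) + (if as ! i = Some v then 1 else 0)"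
      if "v \<in> {-L..L}" "i < length as" for v i
      using Cons.prems(5)[of v "Suc i"] that by simp
  qed (use Cons.prems in \<open>auto intro: order_trans\<close>)
  moreover have "(flow_term N M has_sum
      2 * ((\<Sum>x\<in>{a<..<b}. flow_update L (flow_coeff L as) c x * M x (\<tau> 0))
        - (\<Sum>x\<in>{a<..<b}. flow_coeff L as x * M x (\<tau> (Suc 0))))) {\<tau> 0<..\<tau> (Suc 0)}"
  proof (rule flow_cell[OF M N])
    show "N v (\<tau> (Suc 0)) = N v (\<tau> 0) + (if c = Some v then 1 else 0)" if "v \<in> {-L..L}" for v
      using Cons.prems(5)[of v 0] that by simp
    show "flow_coeff L as x = 0" if "x \<notin> {a<..<b}" for x
      using flow_coeff_outside[of a as b x L] that ab Cons.prems by simp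
  qed (use Cons.prems ab in auto)
  ultimately have "(flow_term N M has_sum
      (2 * ((\<Sum>x\<in>{a<..<b}. flow_update L (flow_coeff L as) c x * M x (\<tau> 0))
        - (\<Sum>x\<in>{a<..<b}. flow_coeff L as x * M x (\<tau> (Suc 0)))) +
       2 * (\<Sum>x\<in>{a<..<b}. flow_coeff L as x * M x (\<tau> (Suc 0)))))
      ({\<tau> 0<..\<tau> (Suc 0)} \<union> {\<tau> (Suc 0)<..\<tau> (Suc (length as))})"
    by (intro has_sum_Un_disjoint) auto
  moreover have "{\<tau> 0<..\<tau> (Suc 0)} \<union> {\<tau> (Suc 0)<..\<tau> (Suc (length as))} = {\<tau> 0<..\<tau> (Suc (length as))}"
    using Cons.prems(2)[of 0] mono[of "Suc (length as)"] by auto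
  ultimately show ?case by (simp add: algebra_simps)
qed simp

lemma net_flow_linear:
  fixes L a b :: int and \<tau> :: "nat \<Rightarrow> real"
  assumes M: "meteor_path UNIV int_adj N M" and N: "\<And>v. counting_path (N v)"
    and \<tau>: "\<tau> 0 = 0" "\<And>i. \<tau> i \<le> \<tau> (Suc i)" "\<tau> (length as) = t"
    and ab: "- L \<le> a" "a < 0" "1 < b" "b \<le> L" "Some a \<notin> set as" "Some b \<notin> set as"
    and c: "\<And>v i. v \<in> {-L..L} \<Longrightarrow> i < length as \<Longrightarrow>
      N v (\<tau> (Suc i)) = N v (\<tau> i) + (if as ! i = Some v then 1 else 0)"
  shows "net_flow N M 0 t = (\<Sum>x\<in>{-L..L}. flow_coeff L as x * M x 0)"
proof -
  have "0 \<le> t"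
    using lift_Suc_mono_le[of \<tau> 0 "length as"] \<tau> by simp
  \<comment> \<open>By convention the left limit at time 0 is the value there, so the closed end of
    the interval adds nothing.\<close>
  have "flow_term N M 0 = 0"
    by (simp add: flow_term_def left_lim_def)
  then have "(flow_term N M has_sum 0) {0}"
    using has_sum_finite[of "{0}" "flow_term N M"] by simp
  moreover have "(flow_term N M has_sum 2 * (\<Sum>x\<in>{a<..<b}. flow_coeff L as x * M x 0)) {0<..t}"
    using flow_linear[OF M N, where \<tau>=\<tau> and L=L and a=a and b=b and as=as] \<tau> ab c by simp
  ultimately have "(flow_term N M has_sum 0 + 2 * (\<Sum>x\<in>{a<..<b}. flow_coeff L as x * M x 0)) ({0} \<union> {0<..t})"
    by (intro has_sum_Un_disjoint) auto
  moreover have "{0} \<union> {0<..t} = {0..t}" using \<open>0 \<le> t\<close> by auto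
  ultimately have "net_flow N M 0 t = (\<Sum>x\<in>{a<..<b}. flow_coeff L as x * M x 0)"
    by (simp add: net_flow_def flow_term_def[abs_def] infsumI)
  \<comment> \<open>The full window makes the formula independent of which silent sites were
    found.\<close>
  also have "\<dots> = (\<Sum>x\<in>{-L..L}. flow_coeff L as x * M x 0)"
    using ab by (intro sum.mono_neutral_left) (auto simp: flow_coeff_outside[OF ab(5,6) ab(2,3)])
  finally show ?thesis .
qed

section \<open>The invariant two-point function of the circle\<close>

text \<open>This is the generator of simple random walk on the circle; column \<open>v\<close> is
  also the change of the configuration, per unit of mass at \<open>v\<close>, when \<open>v\<close>
  jumps.\<close>

definition circle_lap :: "nat \<Rightarrow> int \<Rightarrow> int \<Rightarrow> real" where
  "circle_lap k u v = (if u = v then - 1 else if circle_adj k u v then 1 / 2 else 0)"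

lemma circle_adj_sym: "circle_adj k u v \<longleftrightarrow> circle_adj k v u"
  by (auto simp: circle_adj_def)

lemma circle_lap_sym: "circle_lap k u v = circle_lap k v u"
  by (auto simp: circle_lap_def circle_adj_sym[of k u v])

lemma circle_adj_irrefl: "2 \<le> k \<Longrightarrow> \<not> circle_adj k v v"
  by (auto simp: circle_adj_def)

lemma circle_neighbors:
  assumes "2 \<le> k" "u \<in> circle_vertices k"
  shows "neighbors (circle_vertices k) (circle_adj k) u
    = {if u = int k then 1 else u + 1, if u = 1 then int k else u - 1}"
  using assms by (auto simp: neighbors_def circle_vertices_def circle_adj_def)

lemma card_circle_neighbors:
  assumes "3 \<le> k" "u \<in> circle_vertices k"
  shows "card (neighbors (circle_vertices k) (circle_adj k) u) = 2"
proof -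
  have "(if u = int k then 1 else u + 1) \<noteq> (if u = 1 then int k else u - 1)"
    using assms by (auto simp: circle_vertices_def)
  then show ?thesis
    using assms by (simp only: circle_neighbors) simp
qed

lemma sum_circle_lap:
  assumes "3 \<le> k" "u \<in> circle_vertices k"
  shows "(\<Sum>v\<in>circle_vertices k. circle_lap k u v) = 0"
proof -
  have fin: "finite (circle_vertices k)" by (simp add: circle_vertices_def)
  let ?n = "neighbors (circle_vertices k) (circle_adj k) u"
  have "(\<Sum>v\<in>circle_vertices k. circle_lap k u v)
      = (\<Sum>v\<in>circle_vertices k. (if v = u then - 1 else 0) + (if v \<in> ?n then 1 / 2 else 0))"
    using assms circle_adj_irrefl[of k u]
    by (intro sum.cong) (auto simp: circle_lap_def neighbors_def)
  also have "\<dots> = - 1 + (\<Sum>v\<in>circle_vertices k \<inter> ?n. 1 / 2)"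
    unfolding sum.distrib sum.inter_restrict[OF fin] using fin assms by simp
  also have "circle_vertices k \<inter> ?n = ?n" by (auto simp: neighbors_def)
  finally show ?thesis using card_circle_neighbors[OF assms] by simp
qed

text \<open>The projection of the integers onto the circle, which lets walks around the circle be
  written without case distinctions at the seam.\<close>

definition circle_site :: "nat \<Rightarrow> int \<Rightarrow> int" where
  "circle_site k j = (j - 1) mod int k + 1"

lemma circle_site_in: "0 < k \<Longrightarrow> circle_site k j \<in> circle_vertices k"
  by (auto simp: circle_site_def circle_vertices_def intro: zless_imp_add1_zle)

lemma circle_site_id: "u \<in> circle_vertices k \<Longrightarrow> circle_site k u = u"
  by (auto simp: circle_site_def circle_vertices_def)

lemma circle_site_adj:
  assumes "0 < k"
  shows "circle_adj k (circle_site k j) (circle_site k (j + 1))"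
proof -
  have "(j - 1) mod int k = int k - 1 \<or> (j - 1) mod int k + 1 < int k"
    using pos_mod_bound[of "int k" "j - 1"] assms by linarith
  then have "j mod int k = (if (j - 1) mod int k = int k - 1 then 0 else (j - 1) mod int k + 1)"
    using zmod_trivial_iff[of "(j - 1) mod int k + 1" "int k"] mod_add_left_eq[of "j - 1" "int k" 1] assms
    by auto
  then show ?thesis by (auto simp: circle_site_def circle_adj_def)
qed

lemma circle_site_neq:
  assumes "0 < g" "g < int k"
  shows "circle_site k i \<noteq> circle_site k (i + g)"
proof
  assume "circle_site k i = circle_site k (i + g)"
  then have "(i + g - 1) mod int k = (i - 1) mod int k" by (simp add: circle_site_def)
  then have "int k dvd g" by (simp add: mod_eq_dvd_iff)
  then show False using assms zdvd_not_zless by blast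
qed

lemma circle_site_diff: "circle_site k (i + (u - i) mod int k) = circle_site k u"
proof -
  have "circle_site k (i + (u - i) mod int k) = circle_site k (i + (u - i))"
    unfolding circle_site_def by (metis diff_add_eq mod_add_right_eq)
  then show ?thesis by simp
qed

lemma circle_site_surj:
  assumes "0 < k" "u \<in> circle_vertices k"
  obtains n where "u = circle_site k (i + int n)"
proof
  show "u = circle_site k (i + int (nat ((u - i) mod int k)))"
    using assms by (simp add: circle_site_diff circle_site_id)
qed

text \<open>Summing \<open>E (m\<^sub>u + \<Delta>\<^sub>u\<^sub>v m\<^sub>v) (m\<^sub>w + \<Delta>\<^sub>w\<^sub>v m\<^sub>v) - E m\<^sub>u m\<^sub>w\<close> over the jumping site \<open>v\<close> gives the left-hand side
  for \<open>G u w = E m\<^sub>u m\<^sub>w\<close>.\<close>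

definition circle_invariant :: "nat \<Rightarrow> (int \<Rightarrow> int \<Rightarrow> real) \<Rightarrow> bool" where
  "circle_invariant k G \<longleftrightarrow> (\<forall>u\<in>circle_vertices k. \<forall>w\<in>circle_vertices k.
    (\<Sum>v\<in>circle_vertices k. circle_lap k u v * G v w + circle_lap k w v * G u v
      + circle_lap k u v * circle_lap k w v * G v v) = 0)"

context
  fixes k :: nat and V :: "int set" and \<Delta> :: "int \<Rightarrow> int \<Rightarrow> real"
  assumes k: "3 \<le> k"
  defines "V \<equiv> circle_vertices k" and "\<Delta> \<equiv> circle_lap k"
begin

lemma circle_invariantD:
  "circle_invariant k G \<Longrightarrow> u \<in> V \<Longrightarrow> w \<in> V \<Longrightarrow>
    (\<Sum>v\<in>V. \<Delta> u v * G v w + \<Delta> w v * G u v + \<Delta> u v * \<Delta> w v * G v v) = 0"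
  by (simp add: circle_invariant_def V_def \<Delta>_def)

lemma circle_invariantI:
  "(\<And>u w. u \<in> V \<Longrightarrow> w \<in> V \<Longrightarrow>
    (\<Sum>v\<in>V. \<Delta> u v * G v w + \<Delta> w v * G u v + \<Delta> u v * \<Delta> w v * G v v) = 0) \<Longrightarrow> circle_invariant k G"
  by (simp add: circle_invariant_def V_def \<Delta>_def)

lemma finite_circle: "finite V"
  by (simp add: V_def circle_vertices_def)

lemma circle_lap_nonneg: "u \<noteq> v \<Longrightarrow> 0 \<le> \<Delta> u v"
  by (simp add: \<Delta>_def circle_lap_def)

lemma circle_lap_same: "\<Delta> u u = - 1"
  by (simp add: \<Delta>_def circle_lap_def)

text \<open>All jump rates of the two-particle chain are nonnegative, so a zero of a nonnegative invariant
  function spreads to its predecessors. The terms \<open>v = u\<close> and \<open>v = w\<close> cancel.\<close>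

lemma circle_invariant_zero_step:
  assumes inv: "circle_invariant k Y" and pos: "\<forall>u\<in>V. \<forall>w\<in>V. 0 \<le> Y u w"
    and z: "Y u w = 0" "u \<in> V" "w \<in> V" and v: "v \<in> V" "v \<noteq> u" "v \<noteq> w"
  shows "\<Delta> u v * Y v w = 0" "\<Delta> w v * Y u v = 0" "\<Delta> u v * \<Delta> w v * Y v v = 0"
proof -
  let ?T = "\<lambda>v. \<Delta> u v * Y v w + \<Delta> w v * Y u v + \<Delta> u v * \<Delta> w v * Y v v"
  have "sum ?T V = 0" using circle_invariantD[OF inv z(2,3)] .
  moreover have "sum ?T {u, w} = 0"
    using z circle_lap_same by (cases "u = w") auto
  moreover have "sum ?T V = sum ?T {u, w} + sum ?T (V - {u, w})"
    using finite_circle z by (subst sum.union_disjoint[symmetric]) (auto intro: sum.cong)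
  ultimately have "sum ?T (V - {u, w}) = 0"
    by simp
  moreover have "0 \<le> \<Delta> u x * Y x w" "0 \<le> \<Delta> w x * Y u x" "0 \<le> \<Delta> u x * \<Delta> w x * Y x x"
    if "x \<in> V - {u, w}" for x
    using that z pos circle_lap_nonneg[of u x] circle_lap_nonneg[of w x] by auto
  ultimately have "?T v = 0" "0 \<le> \<Delta> u v * Y v w" "0 \<le> \<Delta> w v * Y u v" "0 \<le> \<Delta> u v * \<Delta> w v * Y v v"
    using v finite_circle sum_nonneg_0[of "V - {u, w}" ?T v] by auto
  then show "\<Delta> u v * Y v w = 0" "\<Delta> w v * Y u v = 0" "\<Delta> u v * \<Delta> w v * Y v v = 0"
    by linarith+
qed

text \<open>This is irreducibility of the two-particle chain. Distinct sites are written as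
  \<open>i\<close> and \<open>i + g\<close>. A zero spreads by shrinking or widening the gap
  \<open>g\<close> and by moving the left particle, so the gap is first reduced to 1, the adjacent
  pair is rotated around the circle, and the gap is reopened. The diagonal is reached through the
  product term: both particles at \<open>u\<close> can leave it together for the two sides, so a
  zero at the pair of its neighbors forces one at \<open>u\<close>. A zero on the diagonal first
  yields one off it.\<close>

lemma circle_invariant_zero:
  assumes inv: "circle_invariant k Y" and pos: "\<forall>u\<in>V. \<forall>w\<in>V. 0 \<le> Y u w"
    and z: "Y u0 w0 = 0" "u0 \<in> V" "w0 \<in> V" and uw: "u \<in> V" "w \<in> V"
  shows "Y u w = 0"
proof -
  let ?r = "circle_site k"
  have kpos: "0 < k" using k by simp
  have rV: "?r j \<in> V" for j using circle_site_in[OF kpos] by (simp add: V_def)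
  have adj: "\<Delta> (?r j) (?r (j + 1)) = 1 / 2" "\<Delta> (?r (j + 1)) (?r j) = 1 / 2" for j
    using circle_site_adj[OF kpos, of j] circle_site_neq[of 1 k j] k circle_adj_sym[of k "?r j" "?r (j + 1)"]
    by (auto simp: \<Delta>_def circle_lap_def)
  have neq: "?r i \<noteq> ?r j" if "i < j" "j < i + int k" for i j
    using circle_site_neq[of "j - i" k i] that by simp
  note step = circle_invariant_zero_step[OF inv pos _ rV rV rV]
  have up: "Y (?r i) (?r (i + g + 1)) = 0" if "Y (?r i) (?r (i + g)) = 0" "1 \<le> g" "g + 1 < int k" for i g
    using step(2)[OF that(1), of "i + g + 1"] that neq[of i "i + g + 1"] neq[of "i + g" "i + g + 1"] adj(1)[of "i + g"]
    by auto
  have down: "Y (?r i) (?r (i + g - 1)) = 0" if "Y (?r i) (?r (i + g)) = 0" "2 \<le> g" "g < int k" for i g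
    using step(2)[OF that(1), of "i + g - 1"] that neq[of i "i + g - 1"] neq[of "i + g - 1" "i + g"] adj(2)[of "i + g - 1"]
    by auto
  have right: "Y (?r (i + 1)) (?r (i + g)) = 0" if "Y (?r i) (?r (i + g)) = 0" "2 \<le> g" "g < int k" for i g
    using step(1)[OF that(1), of "i + 1"] that neq[of i "i + 1"] neq[of "i + 1" "i + g"] adj(1)[of i]
    by auto
  have to_one: "Y (?r i) (?r (i + 1)) = 0" if "Y (?r i) (?r (i + 1 + int n)) = 0" "1 + int n < int k" for i n
    using that
  proof (induction n)
    case (Suc n)
    then show ?case using down[of i "1 + int (Suc n)"] by (simp add: algebra_simps)
  qed simp
  have from_one: "Y (?r i) (?r (i + 1 + int n)) = 0" if "Y (?r i) (?r (i + 1)) = 0" "1 + int n < int k" for i n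
    using that
  proof (induction n)
    case (Suc n)
    then show ?case using up[of i "1 + int n"] by (simp add: algebra_simps)
  qed simp
  have rotate: "Y (?r (i + int n)) (?r (i + int n + 1)) = 0" if "Y (?r i) (?r (i + 1)) = 0" for i n
  proof (induction n)
    case (Suc n)
    have "Y (?r (i + int n)) (?r (i + int n + 2)) = 0"
      using up[OF Suc] k by (simp add: algebra_simps)
    then show ?case using right[of "i + int n" 2] k by (simp add: algebra_simps)
  qed (use that in simp)
  have offset: "\<exists>n. u = ?r i \<and> w = ?r (i + 1 + int n) \<and> 1 + int n < int k"
    if "u \<in> V" "w \<in> V" "u \<noteq> w" "u = ?r i" for u w i
  proof -
    define g where "g = (w - i) mod int k"
    have "w = ?r (i + g)"
      using that(2) by (simp add: g_def circle_site_diff circle_site_id V_def)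
    moreover have "0 \<le> g" "g < int k" using kpos by (simp_all add: g_def)
    moreover have "g \<noteq> 0" using \<open>w = ?r (i + g)\<close> that by auto
    ultimately show ?thesis using that by (intro exI[of _ "nat (g - 1)"]) simp
  qed
  have id: "?r x = x" if "x \<in> V" for x using that by (simp add: circle_site_id V_def)
  obtain u1 w1 where z1: "u1 \<in> V" "w1 \<in> V" "u1 \<noteq> w1" "Y u1 w1 = 0"
  proof (cases "u0 = w0")
    case True
    have "Y (?r (u0 + 1)) (?r u0) = 0"
      using step(1)[of u0 u0 "u0 + 1"] z True neq[of u0 "u0 + 1"] adj(1)[of u0] id[of u0] k by auto
    then show ?thesis using that[of "?r (u0 + 1)" "?r u0"] rV neq[of u0 "u0 + 1"] k by auto
  qed (use z that in auto)
  have one: "Y (?r (u1 + int n)) (?r (u1 + int n + 1)) = 0" for n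
  proof (rule rotate)
    obtain m where "w1 = ?r (u1 + 1 + int m)" "1 + int m < int k"
      using offset[OF z1(1-3) id[OF z1(1), symmetric]] by blast
    then show "Y (?r u1) (?r (u1 + 1)) = 0"
      using to_one[of u1 m] z1 id[OF z1(1)] by simp
  qed
  have off: "Y u w = 0" if uw: "u \<in> V" "w \<in> V" "u \<noteq> w" for u w
  proof -
    obtain n where n: "u = ?r (u1 + int n)" using circle_site_surj[OF kpos] uw(1) V_def by blast
    obtain m where "w = ?r (u1 + int n + 1 + int m)" "1 + int m < int k"
      using offset[OF uw n] by blast
    then show ?thesis using from_one[OF one] n by simp
  qed
  show ?thesis
  proof (cases "u = w")
    case True
    have "?r (u - 1) \<noteq> ?r (u + 1)" "?r (u - 1) \<noteq> ?r u" "?r u \<noteq> ?r (u + 1)"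
      using neq[of "u - 1" "u + 1"] neq[of "u - 1" u] neq[of u "u + 1"] k by auto
    then show ?thesis
      using step(3)[of "u - 1" "u + 1" u] off[OF rV rV, of "u - 1" "u + 1"] adj(1)[of "u - 1"] adj(2)[of u]
        id[OF uw(1)] True by auto
  qed (use off uw in auto)
qed

text \<open>A Perron-Frobenius argument. \<open>H\<close> is a positive invariant function, and for
  the minimal ratio \<open>c\<close> of \<open>G\<close> to \<open>H\<close> the function
  \<open>G - c * H\<close> is nonnegative, invariant and zero somewhere, hence zero everywhere. The
  prescribed total then forces \<open>c = 1\<close>.\<close>

lemma circle_invariant_unique:
  assumes inv: "circle_invariant k G" and total: "(\<Sum>u\<in>V. \<Sum>w\<in>V. G u w) = (real k)\<^sup>2"
    and uw: "u \<in> V" "w \<in> V"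
  shows "G u w = 1 - \<Delta> u w"
proof -
  have sym: "\<Delta> u v = \<Delta> v u" for u v by (simp add: \<Delta>_def circle_lap_sym)
  have sum0: "(\<Sum>v\<in>V. \<Delta> u v) = 0" if "u \<in> V" for u
    using sum_circle_lap[OF k] that by (simp add: \<Delta>_def V_def)
  define H where "H u w = 1 - \<Delta> u w" for u w
  have Hpos: "0 < H u w" for u w by (simp add: H_def \<Delta>_def circle_lap_def)
  \<comment> \<open>Since \<open>H v v = 2\<close> and \<open>\<Delta>\<close> is symmetric, the
    products of two entries of \<open>\<Delta>\<close> cancel and only row sums remain.\<close>
  have "(\<Sum>v\<in>V. \<Delta> u v * H v w + \<Delta> w v * H u v + \<Delta> u v * \<Delta> w v * H v v) = 0"
    if "u \<in> V" "w \<in> V" for u w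
  proof -
    have "(\<Sum>v\<in>V. \<Delta> u v * H v w + \<Delta> w v * H u v + \<Delta> u v * \<Delta> w v * H v v) = (\<Sum>v\<in>V. \<Delta> u v + \<Delta> w v)"
      by (intro sum.cong refl) (simp add: H_def circle_lap_same sym[of _ w] algebra_simps)
    then show ?thesis using sum0 that by (simp add: sum.distrib)
  qed
  then have invH: "circle_invariant k H" by (rule circle_invariantI)
  define R where "R = (\<lambda>(u, w). G u w / H u w) ` (V \<times> V)"
  define c where "c = Min R"
  have R: "finite R" "R \<noteq> {}" using finite_circle uw by (auto simp: R_def)
  obtain u0 w0 where z: "u0 \<in> V" "w0 \<in> V" "c = G u0 w0 / H u0 w0"
  proof -
    have "c \<in> R" using Min_in[OF R] by (simp add: c_def)
    then show thesis using that by (auto simp: R_def)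
  qed
  have "c \<le> G u w / H u w" if "u \<in> V" "w \<in> V" for u w
    unfolding c_def by (rule Min_le[OF R(1)]) (use that in \<open>auto simp: R_def\<close>)
  then have pos: "\<forall>u\<in>V. \<forall>w\<in>V. 0 \<le> G u w - c * H u w"
    using Hpos by (simp add: pos_le_divide_eq)
  have "circle_invariant k (\<lambda>u w. G u w - c * H u w)"
  proof (rule circle_invariantI)
    fix u w assume *: "u \<in> V" "w \<in> V"
    have "(\<Sum>v\<in>V. \<Delta> u v * (G v w - c * H v w) + \<Delta> w v * (G u v - c * H u v) + \<Delta> u v * \<Delta> w v * (G v v - c * H v v))
      = (\<Sum>v\<in>V. \<Delta> u v * G v w + \<Delta> w v * G u v + \<Delta> u v * \<Delta> w v * G v v)
        - c * (\<Sum>v\<in>V. \<Delta> u v * H v w + \<Delta> w v * H u v + \<Delta> u v * \<Delta> w v * H v v)"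
      by (simp add: sum_distrib_left flip: sum_subtractf) (intro sum.cong refl, simp add: algebra_simps)
    then show "(\<Sum>v\<in>V. \<Delta> u v * (G v w - c * H v w) + \<Delta> w v * (G u v - c * H u v)
        + \<Delta> u v * \<Delta> w v * (G v v - c * H v v)) = 0"
      using circle_invariantD[OF inv *] circle_invariantD[OF invH *] by simp
  qed
  from circle_invariant_zero[OF this pos _ z(1,2)] z(3) Hpos[of u0 w0]
  have G: "G u w = c * H u w" if "u \<in> V" "w \<in> V" for u w
    using that by simp
  have "(\<Sum>u\<in>V. \<Sum>w\<in>V. G u w) = c * (\<Sum>u\<in>V. \<Sum>w\<in>V. H u w)"
    by (simp add: sum_distrib_left G)
  also have "(\<Sum>u\<in>V. \<Sum>w\<in>V. H u w) = (real k)\<^sup>2"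
    by (simp add: H_def sum_subtractf sum0) (simp add: V_def circle_vertices_def power2_eq_square)
  finally have "c = 1" using total k by simp
  then show ?thesis using G[OF uw] by (simp add: H_def)
qed

end

section \<open>Independence of clock increments and initial masses\<close>

text \<open>Independence is tested on sets only; it passes to integrals because the image under
  \<open>X\<close> of the measure restricted to \<open>E\<close> is a multiple of the law of
  \<open>X\<close>.\<close>

lemma nn_integral_indep_event:
  assumes X[measurable]: "X \<in> measurable \<Omega> S" and E[measurable]: "E \<in> sets \<Omega>"
    and indep: "\<And>A. A \<in> sets S \<Longrightarrow>
      emeasure \<Omega> (E \<inter> (X -` A \<inter> space \<Omega>)) = emeasure \<Omega> E * emeasure \<Omega> (X -` A \<inter> space \<Omega>)"
    and f[measurable]: "f \<in> borel_measurable S"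
  shows "(\<integral>\<^sup>+\<omega>. indicator E \<omega> * f (X \<omega>) \<partial>\<Omega>) = emeasure \<Omega> E * (\<integral>\<^sup>+x. f x \<partial>distr \<Omega> S X)"
proof -
  have "distr (density \<Omega> (indicator E)) S X = scale_measure (emeasure \<Omega> E) (distr \<Omega> S X)"
  proof (rule measure_eqI)
    fix A assume "A \<in> sets (distr (density \<Omega> (indicator E)) S X)"
    then have A[measurable]: "A \<in> sets S" by simp
    have "emeasure (distr (density \<Omega> (indicator E)) S X) A
        = (\<integral>\<^sup>+\<omega>. indicator E \<omega> * indicator (X -` A \<inter> space \<Omega>) \<omega> \<partial>\<Omega>)"
      by (simp add: emeasure_distr emeasure_density)
    also have "\<dots> = emeasure \<Omega> (E \<inter> (X -` A \<inter> space \<Omega>))"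
      by (simp add: indicator_inter_arith[symmetric])
    finally show "emeasure (distr (density \<Omega> (indicator E)) S X) A
        = emeasure (scale_measure (emeasure \<Omega> E) (distr \<Omega> S X)) A"
      using indep[OF A] by (simp add: emeasure_distr)
  qed simp
  then have "(\<integral>\<^sup>+x. f x \<partial>distr (density \<Omega> (indicator E)) S X) = emeasure \<Omega> E * (\<integral>\<^sup>+x. f x \<partial>distr \<Omega> S X)"
    by (simp add: nn_integral_scale_measure)
  then show ?thesis
    by (simp add: nn_integral_distr nn_integral_density)
qed

text \<open>The subtraction is the truncated one of natural numbers; on counting paths it is the
  true increment.\<close>

definition grid_event ::
  "'w measure \<Rightarrow> ('v \<Rightarrow> real \<Rightarrow> 'w \<Rightarrow> nat) \<Rightarrow> real \<Rightarrow> nat \<Rightarrow> 'v set \<Rightarrow> ('v \<Rightarrow> nat \<Rightarrow> nat set) \<Rightarrow> 'w set" where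
  "grid_event \<Omega> N h m B K = {\<omega>\<in>space \<Omega>. \<forall>v\<in>B. \<forall>i<m. N v (real (Suc i) * h) \<omega> - N v (real i * h) \<omega> \<in> K v i}"

text \<open>Turning the generated events into the sets of a measure \<open>F\<close> reduces
  membership to measurability with respect to \<open>F\<close>.\<close>

lemma generated_events_measurable:
  assumes "\<And>i. i \<in> I \<Longrightarrow> X i \<in> space \<Omega> \<rightarrow> space S"
  defines "F \<equiv> sigma (space \<Omega>) (\<Union>i\<in>I. {X i -` A \<inter> space \<Omega> | A. A \<in> sets S})"
  shows "sets F = generated_events \<Omega> S I X" "space F = space \<Omega>" "i \<in> I \<Longrightarrow> X i \<in> measurable F S"
proof -
  have sub: "(\<Union>i\<in>I. {X i -` A \<inter> space \<Omega> | A. A \<in> sets S}) \<subseteq> Pow (space \<Omega>)" by auto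
  show sets: "sets F = generated_events \<Omega> S I X"
    unfolding F_def generated_events_def using sub by (rule sets_measure_of)
  show space: "space F = space \<Omega>"
    by (simp add: F_def space_measure_of_conv)
  show "X i \<in> measurable F S" if "i \<in> I"
  proof (rule measurableI)
    show "X i x \<in> space S" if "x \<in> space F" for x
      using assms(1)[OF \<open>i \<in> I\<close>] that space by auto
    show "X i -` A \<inter> space F \<in> sets F" if "A \<in> sets S" for A
      unfolding sets generated_events_def space using that \<open>i \<in> I\<close> by (intro sigma_sets.Basic) auto
  qed
qed

lemma grid_event_generated:
  assumes "0 \<le> h"
  shows "grid_event \<Omega> N h m {v} K \<in> generated_events \<Omega> (count_space UNIV) {0..} (N v)"
proof -
  define F where "F = sigma (space \<Omega>) (\<Union>t\<in>{0::real..}. {N v t -` A \<inter> space \<Omega> | A. A \<in> sets (count_space (UNIV :: nat set))})"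
  note F = generated_events_measurable[where I="{0::real..}" and X="N v" and \<Omega>=\<Omega> and S="count_space UNIV", folded F_def, simplified]
  have [measurable]: "N v (real i * h) \<in> measurable F (count_space UNIV)" for i
    using F(3) assms by simp
  have "{\<omega>\<in>space F. \<forall>i<m. N v (real (Suc i) * h) \<omega> - N v (real i * h) \<omega> \<in> K v i} \<in> sets F"
    by measurable
  then show ?thesis by (simp add: grid_event_def F)
qed

lemma config_generated:
  assumes "A \<in> sets (Pi\<^sub>M V (\<lambda>_. borel))"
  shows "(\<lambda>\<omega>. \<lambda>v\<in>V. M v 0 \<omega> :: real) -` A \<inter> space \<Omega> \<in> generated_events \<Omega> borel V (\<lambda>v. M v (0::real))"
proof -
  define F where "F = sigma (space \<Omega>) (\<Union>v\<in>V. {M v 0 -` A \<inter> space \<Omega> | A. A \<in> sets borel})"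
  note F = generated_events_measurable[where I=V and X="\<lambda>v. M v 0" and \<Omega>=\<Omega> and S=borel, folded F_def, simplified]
  have "(\<lambda>\<omega>. \<lambda>v\<in>V. M v 0 \<omega>) \<in> measurable F (Pi\<^sub>M V (\<lambda>_. borel))"
    by (intro measurable_restrict F)
  from measurable_sets[OF this assms] show ?thesis by (simp add: F)
qed

locale meteor =
  fixes \<Omega> :: "'w measure" and V :: "'v set" and E :: "'v \<Rightarrow> 'v \<Rightarrow> bool"
    and N :: "'v \<Rightarrow> real \<Rightarrow> 'w \<Rightarrow> nat" and M :: "'v \<Rightarrow> real \<Rightarrow> 'w \<Rightarrow> real"
  assumes meteor: "meteor_process \<Omega> V E N M"
begin

sublocale prob_space \<Omega>
  using meteor by (simp add: meteor_process_def)

lemma poisson: "v \<in> V \<Longrightarrow> poisson_process \<Omega> 1 (N v)"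
  using meteor by (simp add: meteor_process_def)

lemma measurable_N: "v \<in> V \<Longrightarrow> 0 \<le> t \<Longrightarrow> N v t \<in> measurable \<Omega> (count_space UNIV)"
  using poisson by (simp add: poisson_process_def)

lemma measurable_M: "v \<in> V \<Longrightarrow> 0 \<le> t \<Longrightarrow> M v t \<in> borel_measurable \<Omega>"
  using meteor by (simp add: meteor_process_def)

lemma measurable_config: "0 \<le> t \<Longrightarrow> (\<lambda>\<omega>. \<lambda>v\<in>V. M v t \<omega>) \<in> measurable \<Omega> (Pi\<^sub>M V (\<lambda>_. borel))"
  by (intro measurable_restrict measurable_M)

lemma grid_event_sets:
  assumes "finite B" "B \<subseteq> V" "0 \<le> h"
  shows "grid_event \<Omega> N h m B K \<in> sets \<Omega>"
proof -
  have "{\<omega>\<in>space \<Omega>. \<forall>i<m. N v (real (Suc i) * h) \<omega> - N v (real i * h) \<omega> \<in> K v i} \<in> sets \<Omega>" if "v \<in> B" for v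
  proof -
    have [measurable]: "N v (real i * h) \<in> measurable \<Omega> (count_space UNIV)" for i
      using measurable_N[of v] assms that by auto
    show ?thesis by measurable
  qed
  then show ?thesis
    unfolding grid_event_def by (rule sets.sets_Collect_finite_All[OF _ assms(1)])
qed

lemma prob_grid_event_single:
  assumes "v \<in> V" "0 < h"
  shows "prob (grid_event \<Omega> N h m {v} K) = (\<Prod>i<m. measure_pmf.prob (poisson_pmf h) (K v i))"
\<comment> \<open>An empty intersection is \<open>UNIV\<close> and not
  \<open>space \<Omega>\<close>, so a grid without cells is treated separately.\<close>
proof (cases "m = 0")
  case False
  let ?X = "\<lambda>i \<omega>. N v (real (Suc i) * h) \<omega> - N v (real i * h) \<omega>"
  have "indep_vars (\<lambda>_. count_space UNIV) ?X {..<m}"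
    using poisson[OF assms(1)] assms(2)
    unfolding poisson_process_def by (auto dest!: spec[of _ m] spec[of _ "\<lambda>i. real i * h"] simp: mult_right_mono)
  then have "prob (\<Inter>i\<in>{..<m}. ?X i -` K v i \<inter> space \<Omega>) = (\<Prod>i<m. prob (?X i -` K v i \<inter> space \<Omega>))"
    using False by (intro indep_varsD[where I="{..<m}"]) auto
  moreover have "(\<Inter>i\<in>{..<m}. ?X i -` K v i \<inter> space \<Omega>) = grid_event \<Omega> N h m {v} K"
    using False by (auto simp: grid_event_def)
  moreover have "prob (?X i -` K v i \<inter> space \<Omega>) = measure_pmf.prob (poisson_pmf h) (K v i)" for i
  proof -
    have "distr \<Omega> (count_space UNIV) (?X i) = measure_pmf (poisson_pmf (1 * (real (Suc i) * h - real i * h)))"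
      using poisson[OF assms(1)] assms(2) unfolding poisson_process_def by simp
    moreover have "1 * (real (Suc i) * h - real i * h) = h" by (simp add: algebra_simps)
    ultimately have eq: "measure_pmf (poisson_pmf h) = distr \<Omega> (count_space UNIV) (?X i)" by simp
    have [measurable]: "N v (real i * h) \<in> measurable \<Omega> (count_space UNIV)" for i
      using measurable_N[of v "real i * h"] assms by simp
    have "?X i \<in> measurable \<Omega> (count_space UNIV)" by measurable
    from measure_distr[OF this, of "K v i"] show ?thesis by (simp only: eq sets_count_space Pow_UNIV UNIV_I)
  qed
  ultimately show ?thesis by simp
qed (simp add: grid_event_def prob_space)

lemma prob_grid_event_config:
  assumes B: "finite B" "B \<subseteq> V" and h: "0 < h" and A: "A \<in> sets (Pi\<^sub>M V (\<lambda>_. borel))"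
  defines "C \<equiv> (\<lambda>\<omega>. \<lambda>v\<in>V. M v 0 \<omega>) -` A \<inter> space \<Omega>"
  shows "prob (grid_event \<Omega> N h m B K \<inter> C) = (\<Prod>v\<in>B. \<Prod>i<m. measure_pmf.prob (poisson_pmf h) (K v i)) * prob C"
proof -
  define G where "G j = (case j of None \<Rightarrow> C | Some v \<Rightarrow> grid_event \<Omega> N h m {v} K)" for j
  have "prob (\<Inter>j\<in>insert None (Some ` B). G j) = (\<Prod>j\<in>insert None (Some ` B). prob (G j))"
  proof (rule indep_setsD)
    show "indep_sets
       (\<lambda>i. case i of None \<Rightarrow> generated_events \<Omega> borel V (\<lambda>v. M v 0)
            | Some v \<Rightarrow> generated_events \<Omega> (count_space UNIV) {0..} (N v)) (insert None (Some ` V))"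
      using meteor by (simp add: meteor_process_def)
    show "\<forall>j\<in>insert None (Some ` B). G j \<in> (case j of None \<Rightarrow> generated_events \<Omega> borel V (\<lambda>v. M v 0)
            | Some v \<Rightarrow> generated_events \<Omega> (count_space UNIV) {0..} (N v))"
      using config_generated[OF A] grid_event_generated[OF less_imp_le[OF h]] by (auto simp: G_def C_def)
  qed (use B in auto)
  also have "(\<Inter>j\<in>insert None (Some ` B). G j) = grid_event \<Omega> N h m B K \<inter> C"
    by (auto simp: G_def C_def grid_event_def)
  also have "(\<Prod>j\<in>insert None (Some ` B). prob (G j)) = prob C * (\<Prod>v\<in>B. prob (grid_event \<Omega> N h m {v} K))"
    using B by (simp add: prod.reindex G_def)
  also have "(\<Prod>v\<in>B. prob (grid_event \<Omega> N h m {v} K)) = (\<Prod>v\<in>B. \<Prod>i<m. measure_pmf.prob (poisson_pmf h) (K v i))"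
    using B h by (intro prod.cong refl prob_grid_event_single) auto
  finally show ?thesis by simp
qed

lemma prob_grid_event:
  assumes "finite B" "B \<subseteq> V" "0 < h"
  shows "prob (grid_event \<Omega> N h m B K) = (\<Prod>v\<in>B. \<Prod>i<m. measure_pmf.prob (poisson_pmf h) (K v i))"
  using prob_grid_event_config[OF assms sets.top, of m K] measurable_space[OF measurable_config[of 0]]
    grid_event_sets[OF assms(1,2), of h m K] assms(3) sets.sets_into_space
  by (auto simp: prob_space Int_absorb2 vimage_def space_PiM Int_def[symmetric])

lemma nn_integral_grid_event:
  assumes B: "finite B" "B \<subseteq> V" and h: "0 < h" and f: "f \<in> borel_measurable (Pi\<^sub>M V (\<lambda>_. borel))"
  shows "(\<integral>\<^sup>+\<omega>. indicator (grid_event \<Omega> N h m B K) \<omega> * f (\<lambda>v\<in>V. M v 0 \<omega>) \<partial>\<Omega>)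
    = ennreal (\<Prod>v\<in>B. \<Prod>i<m. measure_pmf.prob (poisson_pmf h) (K v i)) * (\<integral>\<^sup>+x. f x \<partial>config_law \<Omega> V M 0)"
proof -
  let ?G = "grid_event \<Omega> N h m B K"
  have G: "?G \<in> sets \<Omega>" using grid_event_sets B h by simp
  have "(\<integral>\<^sup>+\<omega>. indicator ?G \<omega> * f (\<lambda>v\<in>V. M v 0 \<omega>) \<partial>\<Omega>) = emeasure \<Omega> ?G * (\<integral>\<^sup>+x. f x \<partial>config_law \<Omega> V M 0)"
    unfolding config_law_def
  proof (rule nn_integral_indep_event[OF measurable_config G _ f])
    fix A assume A: "A \<in> sets (Pi\<^sub>M V (\<lambda>_. borel :: real measure))"
    show "emeasure \<Omega> (?G \<inter> ((\<lambda>\<omega>. \<lambda>v\<in>V. M v 0 \<omega>) -` A \<inter> space \<Omega>))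
        = emeasure \<Omega> ?G * emeasure \<Omega> ((\<lambda>\<omega>. \<lambda>v\<in>V. M v 0 \<omega>) -` A \<inter> space \<Omega>)"
      using prob_grid_event_config[OF B h A, of m K] prob_grid_event[OF B h, of m K]
      by (simp add: emeasure_eq_measure ennreal_mult[symmetric] prod_nonneg)
  qed simp
  then show ?thesis
    using prob_grid_event[OF B h, of m K] by (simp add: emeasure_eq_measure)
qed

end

context meteor
begin

lemma AE_counting_paths:
  assumes "countable V"
  shows "AE \<omega> in \<Omega>. \<forall>v\<in>V. counting_path (\<lambda>s. N v s \<omega>)"
  unfolding AE_ball_countable[OF assms]
proof
  fix v assume "v \<in> V"
  from poisson[OF this] have "AE \<omega> in \<Omega>. N v 0 \<omega> = 0 \<and> mono_on {0..} (\<lambda>t. N v t \<omega>) \<and>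
        (\<forall>t\<ge>0. continuous (at_right t) (\<lambda>s. N v s \<omega>))"
    by (simp add: poisson_process_def)
  then show "AE \<omega> in \<Omega>. counting_path (\<lambda>s. N v s \<omega>)"
    by eventually_elim (simp add: counting_path_def)
qed

lemma AE_meteor_path:
  "AE \<omega> in \<Omega>. (\<forall>v\<in>V. 0 \<le> M v 0 \<omega>) \<and> meteor_path V E (\<lambda>v s. N v s \<omega>) (\<lambda>v s. M v s \<omega>)"
  using meteor by (simp add: meteor_process_def)

lemma prob_space_config_law: "0 \<le> t \<Longrightarrow> prob_space (config_law \<Omega> V M t)"
  unfolding config_law_def by (rule prob_space_distr) (rule measurable_config)

text \<open>The nonnegative version carries over in all cases: \<open>enn2real\<close> sends
  infinity to 0, the default value of the Bochner integral.\<close>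

lemma integral_grid_event:
  assumes B: "finite B" "B \<subseteq> V" and h: "0 < h"
    and f[measurable]: "f \<in> borel_measurable (Pi\<^sub>M V (\<lambda>_. borel))" and pos: "AE x in config_law \<Omega> V M 0. 0 \<le> f x"
  shows "(\<integral>\<omega>. indicator (grid_event \<Omega> N h m B K) \<omega> * f (\<lambda>v\<in>V. M v 0 \<omega>) \<partial>\<Omega>)
    = (\<Prod>v\<in>B. \<Prod>i<m. measure_pmf.prob (poisson_pmf h) (K v i)) * (\<integral>x. f x \<partial>config_law \<Omega> V M 0)"
proof -
  let ?G = "grid_event \<Omega> N h m B K" and ?c = "\<lambda>\<omega>. \<lambda>v\<in>V. M v 0 \<omega>"
  have [measurable]: "?G \<in> sets \<Omega>" using grid_event_sets B h by simp
  have [measurable]: "?c \<in> measurable \<Omega> (Pi\<^sub>M V (\<lambda>_. borel))" using measurable_config by simp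
  have "AE \<omega> in \<Omega>. 0 \<le> f (?c \<omega>)"
    using pos unfolding config_law_def by (rule AE_distrD[rotated]) measurable
  then have "(\<integral>\<omega>. indicator ?G \<omega> * f (?c \<omega>) \<partial>\<Omega>) = enn2real (\<integral>\<^sup>+\<omega>. ennreal (indicator ?G \<omega> * f (?c \<omega>)) \<partial>\<Omega>)"
    by (intro integral_eq_nn_integral) auto
  also have "(\<integral>\<^sup>+\<omega>. ennreal (indicator ?G \<omega> * f (?c \<omega>)) \<partial>\<Omega>) = (\<integral>\<^sup>+\<omega>. indicator ?G \<omega> * ennreal (f (?c \<omega>)) \<partial>\<Omega>)"
    by (intro nn_integral_cong) (simp split: split_indicator)
  also have "\<dots> = ennreal (\<Prod>v\<in>B. \<Prod>i<m. measure_pmf.prob (poisson_pmf h) (K v i))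
      * (\<integral>\<^sup>+x. ennreal (f x) \<partial>config_law \<Omega> V M 0)"
    by (rule nn_integral_grid_event[OF B h]) measurable
  also have "enn2real \<dots> = (\<Prod>v\<in>B. \<Prod>i<m. measure_pmf.prob (poisson_pmf h) (K v i))
      * enn2real (\<integral>\<^sup>+x. ennreal (f x) \<partial>config_law \<Omega> V M 0)"
    by (simp add: enn2real_mult prod_nonneg)
  also have "enn2real (\<integral>\<^sup>+x. ennreal (f x) \<partial>config_law \<Omega> V M 0) = (\<integral>x. f x \<partial>config_law \<Omega> V M 0)"
    using pos by (intro integral_eq_nn_integral[symmetric]) (simp_all add: config_law_def)
  finally show ?thesis .
qed

end

section \<open>Jumps on the circle and the small-time expansion\<close>

lemma circle_one_jump:
  assumes k: "3 \<le> k" and M: "meteor_path (circle_vertices k) (circle_adj k) N M"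
    and N: "\<And>y. y \<in> circle_vertices k \<Longrightarrow> counting_path (N y)"
    and h: "0 \<le> h" and v: "v \<in> circle_vertices k" and u: "u \<in> circle_vertices k"
    and jump: "\<And>y. y \<in> circle_vertices k \<Longrightarrow> N y h - N y 0 = (if y = v then 1 else 0)"
  shows "M u h = M u 0 + circle_lap k u v * M v 0"
proof -
  have inc: "N y h = N y 0 + (if y = v then 1 else 0)" if "y \<in> circle_vertices k" for y
    using counting_path_mono[OF N[OF that], of 0 h] jump[OF that] h by (auto split: if_splits)
  have nbrs: "neighbors (circle_vertices k) (circle_adj k) x \<subseteq> circle_vertices k" for x
    by (auto simp: neighbors_def)
  have irrefl: "\<not> circle_adj k v v" using circle_adj_irrefl k by simp
  have "N v h = Suc (N v 0)" using inc v by simp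
  moreover have "N y h = N y 0" if "y \<in> neighbors (circle_vertices k) (circle_adj k) v" for y
    using inc[of y] that nbrs[of v] irrefl by (auto simp: neighbors_def)
  ultimately have v0: "M v h = 0" and nbr: "\<And>x. \<lbrakk>x \<in> neighbors (circle_vertices k) (circle_adj k) v;
        \<And>y. y \<in> neighbors (circle_vertices k) (circle_adj k) x \<Longrightarrow> y \<noteq> v \<Longrightarrow> N y h = N y 0\<rbrakk>
       \<Longrightarrow> M x h = M x 0 + M v 0 / 2"
    using meteor_path_jump[OF M v irrefl order.refl h N] card_circle_neighbors[OF k v] by (metis of_nat_numeral)+
  consider "u = v" | "u \<noteq> v" "circle_adj k v u" | "u \<noteq> v" "\<not> circle_adj k v u" by blast
  then show ?thesis
  proof cases
    case 1
    then show ?thesis using v0 by (simp add: circle_lap_def)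
  next
    case 2
    have "M u h = M u 0 + M v 0 / 2"
    proof (rule nbr)
      show "u \<in> neighbors (circle_vertices k) (circle_adj k) v" using 2 u by (simp add: neighbors_def)
      show "N y h = N y 0" if "y \<in> neighbors (circle_vertices k) (circle_adj k) u" "y \<noteq> v" for y
        using that nbrs[of u] inc[of y] by auto
    qed
    then show ?thesis using 2 by (simp add: circle_lap_def circle_adj_sym[of k u v])
  next
    case 3
    have "M u h = M u 0"
    proof (rule meteor_path_unchanged[OF M u order.refl h])
      fix y assume y: "y \<in> insert u (neighbors (circle_vertices k) (circle_adj k) u)"
      then have "y \<in> circle_vertices k" "y \<noteq> v"
        using 3 u circle_adj_sym[of k u v] by (auto simp: neighbors_def)
      then show "counting_path (N y) \<and> N y h = N y 0" using N inc by simp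
    qed
    then show ?thesis using 3 by (simp add: circle_lap_def circle_adj_sym[of k u v])
  qed
qed

lemma circle_no_jump:
  assumes M: "meteor_path (circle_vertices k) (circle_adj k) N M"
    and N: "\<And>y. y \<in> circle_vertices k \<Longrightarrow> counting_path (N y)"
    and h: "0 \<le> h" and u: "u \<in> circle_vertices k"
    and jump: "\<And>y. y \<in> circle_vertices k \<Longrightarrow> N y h - N y 0 = 0"
  shows "M u h = M u 0"
proof (rule meteor_path_unchanged[OF M u order.refl h])
  fix y assume "y \<in> insert u (neighbors (circle_vertices k) (circle_adj k) u)"
  then have "y \<in> circle_vertices k" using u by (auto simp: neighbors_def)
  then show "counting_path (N y) \<and> N y h = N y 0"
    using N[of y] jump[of y] counting_path_mono[of "N y" 0 h] h by auto
qed

text \<open>The first-order term in \<open>h\<close> of the identity \<open>E f (M\<^sub>h) = E f (M\<^sub>0)\<close>; the right-hand side bounds the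
  contribution of two or more jumps.\<close>

lemma first_order_balance:
  fixes q s k C :: real
  assumes "\<And>h. 0 < h \<Longrightarrow> \<bar>q - exp (- (k * h)) * (q + h * s)\<bar> \<le> C * (1 - exp (- (k * h)) * (1 + k * h))"
  shows "s = k * q"
proof -
  have "((\<lambda>h. (q - exp (- (k * h)) * (q + h * s)) / h) \<longlongrightarrow> k * q - s) (at_right 0)"
    by real_asymp
  moreover have "((\<lambda>h. C * (1 - exp (- (k * h)) * (1 + k * h)) / h) \<longlongrightarrow> 0) (at_right 0)"
    by real_asymp
  then have "((\<lambda>h. (q - exp (- (k * h)) * (q + h * s)) / h) \<longlongrightarrow> 0) (at_right 0)"
  proof (rule Lim_null_comparison[rotated])
    show "\<forall>\<^sub>F h in at_right 0. norm ((q - exp (- (k * h)) * (q + h * s)) / h)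
        \<le> C * (1 - exp (- (k * h)) * (1 + k * h)) / h"
      using assms by (auto simp: eventually_at_right_field divide_right_mono intro!: exI[of _ 1])
  qed
  ultimately have "k * q - s = 0"
    by (intro tendsto_unique) auto
  then show ?thesis by simp
qed

section \<open>Second moments on the circle\<close>

lemma poisson_prob_0: "0 < h \<Longrightarrow> measure_pmf.prob (poisson_pmf h) {0} = exp (- h)"
  and poisson_prob_1: "0 < h \<Longrightarrow> measure_pmf.prob (poisson_pmf h) {Suc 0} = h * exp (- h)"
  by (simp_all add: measure_pmf_single)

context meteor
begin

definition jump_event :: "real \<Rightarrow> 'v option \<Rightarrow> 'w set" where
  "jump_event h c = grid_event \<Omega> N h 1 V (\<lambda>v i. {if c = Some v then 1 else 0})"

lemma jump_event_iff:
  "\<omega> \<in> jump_event h c \<longleftrightarrow> \<omega> \<in> space \<Omega> \<and> (\<forall>v\<in>V. N v h \<omega> - N v 0 \<omega> = (if c = Some v then 1 else 0))"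
  by (simp add: jump_event_def grid_event_def)

lemma jump_event_disjoint:
  "c \<in> insert None (Some ` V) \<Longrightarrow> d \<in> insert None (Some ` V) \<Longrightarrow> c \<noteq> d \<Longrightarrow>
    jump_event h c \<inter> jump_event h d = {}"
  by (force simp: jump_event_iff split: if_splits)

lemma integral_jump_event:
  assumes V: "finite V" and h: "0 < h" and c: "c \<in> insert None (Some ` V)"
    and f: "f \<in> borel_measurable (Pi\<^sub>M V (\<lambda>_. borel))" "AE x in config_law \<Omega> V M 0. 0 \<le> f x"
  shows "(\<integral>\<omega>. indicator (jump_event h c) \<omega> * f (\<lambda>v\<in>V. M v 0 \<omega>) \<partial>\<Omega>)
    = (if c = None then 1 else h) * exp (- (real (card V) * h)) * (\<integral>x. f x \<partial>config_law \<Omega> V M 0)"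
proof -
  have "(\<Prod>v\<in>V. \<Prod>i<1::nat. measure_pmf.prob (poisson_pmf h) {if c = Some v then 1 else 0})
     = (\<Prod>v\<in>V. exp (- h) * (if c = Some v then h else 1))"
    using h by (intro prod.cong) (simp_all add: poisson_prob_0 poisson_prob_1)
  also have "\<dots> = exp (- h) ^ card V * (\<Prod>v\<in>V. if c = Some v then h else 1)"
    by (simp add: prod.distrib)
  also have "(\<Prod>v\<in>V. if c = Some v then h else 1) = (if c = None then 1 else h)"
    using c V by auto
  also have "exp (- h) ^ card V = exp (- (real (card V) * h))"
    by (simp flip: exp_of_nat_mult)
  finally show ?thesis
    unfolding jump_event_def using integral_grid_event[OF V order.refl h f, of 1] by (simp add: mult_ac)
qed

lemma jump_event_sets: "finite V \<Longrightarrow> 0 < h \<Longrightarrow> jump_event h c \<in> sets \<Omega>"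
  unfolding jump_event_def by (intro grid_event_sets) auto

lemma prob_jump_event:
  assumes V: "finite V" and h: "0 < h" and c: "c \<in> insert None (Some ` V)"
  shows "prob (jump_event h c) = (if c = None then 1 else h) * exp (- (real (card V) * h))"
proof -
  interpret C: prob_space "config_law \<Omega> V M 0" by (simp add: prob_space_config_law)
  show ?thesis
    using integral_jump_event[OF V h c, of "\<lambda>_. 1"] jump_event_sets[OF V h, of c] C.prob_space
    by simp
qed

end

definition circle_bounded :: "nat \<Rightarrow> (int \<Rightarrow> real) \<Rightarrow> bool" where
  "circle_bounded k m \<longleftrightarrow> (\<forall>j\<in>circle_vertices k. 0 \<le> m j \<and> m j \<le> real k) \<and> (\<Sum>j\<in>circle_vertices k. m j) = real k"

lemma integrable_circle_product:
  assumes "prob_space Q" and sets: "sets Q = sets (Pi\<^sub>M (circle_vertices k) (\<lambda>_. borel))"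
    and bounded: "AE m in Q. circle_bounded k m"
    and u: "u \<in> circle_vertices k" and w: "w \<in> circle_vertices k"
  shows "integrable Q (\<lambda>m. m u * m w)"
proof -
  interpret prob_space Q by fact
  show ?thesis
  proof (rule integrable_const_bound[where B="(real k)\<^sup>2"])
    show "AE m in Q. norm (m u * m w) \<le> (real k)\<^sup>2"
      using bounded u w
      by (auto simp: circle_bounded_def abs_mult power2_eq_square intro!: mult_mono elim!: eventually_mono)
    have "(\<lambda>m. m u * m w) \<in> borel_measurable (Pi\<^sub>M (circle_vertices k) (\<lambda>_. borel :: real measure))"
      using u w by measurable
    then show "(\<lambda>m. m u * m w) \<in> borel_measurable Q"
      using measurable_cong_sets[OF sets refl] by blast
  qed
qed

text \<open>The equation for the two-point function is the first-order term in \<open>h\<close> of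
  the identity between the means of \<open>m u * m w\<close> at times \<open>h\<close> and 0. With
  at most one jump before \<open>h\<close>, the configuration at \<open>h\<close> is an explicit
  function of the initial one, which is independent of the clocks. The remaining event has
  probability of order \<open>h\<^sup>2\<close>, and the product is at most \<open>k\<^sup>2\<close>
  there because the total mass is \<open>k\<close>.\<close>

lemma circle_stationary_invariant:
  assumes k: "3 \<le> k" and Q: "circle_stationary TYPE('w) k Q"
  shows "prob_space Q" "sets Q = sets (Pi\<^sub>M (circle_vertices k) (\<lambda>_. borel))"
    "AE m in Q. circle_bounded k m" "circle_invariant k (\<lambda>u w. \<integral>m. m u * m w \<partial>Q)"
proof -
  let ?V = "circle_vertices k" and ?P = "Pi\<^sub>M (circle_vertices k) (\<lambda>_. borel :: real measure)"
  obtain \<Omega> :: "'w measure" and N M where "meteor_process \<Omega> ?V (circle_adj k) N M"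
    and law: "\<And>t. 0 \<le> t \<Longrightarrow> config_law \<Omega> ?V M t = Q"
    using Q unfolding circle_stationary_def stationary_distribution_def by blast
  then interpret meteor \<Omega> ?V "circle_adj k" N M by unfold_locales
  have fin: "finite ?V" and card: "card ?V = k" by (simp_all add: circle_vertices_def)
  let ?c = "\<lambda>t \<omega>. \<lambda>v\<in>?V. M v t \<omega>"
  have [measurable]: "?c t \<in> measurable \<Omega> ?P" if "0 \<le> t" for t
    using that by (rule measurable_config)
  show "prob_space Q" using prob_space_config_law[of 0] law[of 0] by simp
  then interpret Q: prob_space Q .
  show sets_Q: "sets Q = sets ?P"
    using law[of 0] by (auto simp: config_law_def)
  have "AE m in Q. \<forall>j\<in>?V. 0 \<le> m j"
  proof -
    have "AE \<omega> in \<Omega>. \<forall>j\<in>?V. 0 \<le> ?c 0 \<omega> j"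
      using AE_meteor_path by eventually_elim auto
    moreover have "{m\<in>space ?P. \<forall>j\<in>?V. 0 \<le> m j} \<in> sets ?P"
      using fin by (intro sets.sets_Collect_finite_All) measurable
    then have "(AE m in distr \<Omega> ?P (?c 0). \<forall>j\<in>?V. 0 \<le> m j) \<longleftrightarrow> (AE \<omega> in \<Omega>. \<forall>j\<in>?V. 0 \<le> ?c 0 \<omega> j)"
      by (intro AE_distr_iff measurable_config) auto
    moreover have "distr \<Omega> ?P (?c 0) = Q"
      using law[of 0] by (simp add: config_law_def)
    ultimately show ?thesis by metis
  qed
  moreover have "AE m in Q. (\<Sum>j\<in>?V. m j) = real k"
    using Q by (simp add: circle_stationary_def)
  ultimately show bounded: "AE m in Q. circle_bounded k m"
  proof eventually_elim
    case (elim m)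
    have "m j \<le> (\<Sum>j\<in>?V. m j)" if "j \<in> ?V" for j
      using elim that fin by (intro member_le_sum) auto
    then show ?case using elim by (auto simp: circle_bounded_def)
  qed
  \<comment> \<open>The law at every time is \<open>Q\<close>, so the bound on the masses transfers
    from \<open>Q\<close> to each fixed time.\<close>
  have bounded_t: "AE \<omega> in \<Omega>. circle_bounded k (?c t \<omega>)" if "0 \<le> t" for t
    using bounded unfolding law[OF that, symmetric] config_law_def
    by (rule AE_distrD[rotated]) (use that in measurable)
  show "circle_invariant k (\<lambda>u w. \<integral>m. m u * m w \<partial>Q)"
    unfolding circle_invariant_def
  proof (intro ballI)
    fix u w assume u: "u \<in> ?V" and w: "w \<in> ?V"
    let ?lap = "circle_lap k"
    define f :: "(int \<Rightarrow> real) \<Rightarrow> real" where "f m = m u * m w" for m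
    \<comment> \<open>\<open>T c m\<close> is the value of \<open>f\<close> after the single jump
      \<open>c\<close> has acted on the configuration \<open>m\<close>.\<close>
    define T :: "int option \<Rightarrow> (int \<Rightarrow> real) \<Rightarrow> real" where
      "T c m = (case c of None \<Rightarrow> f m | Some v \<Rightarrow> (m u + ?lap u v * m v) * (m w + ?lap w v * m v))" for c m
    have meas_f[measurable]: "f \<in> borel_measurable ?P"
      unfolding f_def using u w by measurable
    have meas_T[measurable]: "T c \<in> borel_measurable ?P" if "c \<in> insert None (Some ` ?V)" for c
      unfolding T_def f_def using that u w by auto
    have f_bd: "0 \<le> f m \<and> f m \<le> (real k)\<^sup>2" if "circle_bounded k m" for m
      using that u w by (auto simp: circle_bounded_def f_def power2_eq_square intro!: mult_mono)
    have T_pos: "0 \<le> T c m" if "circle_bounded k m" "c \<in> insert None (Some ` ?V)" for c m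
      using that u w by (auto simp: circle_bounded_def f_def T_def circle_lap_def intro!: mult_nonneg_nonneg)
    define q where "q = (\<integral>m. f m \<partial>Q)"
    define s where "s = (\<Sum>v\<in>?V. \<integral>m. T (Some v) m \<partial>Q)"
    have "\<bar>q - exp (- (real k * h)) * (q + h * s)\<bar>
        \<le> (real k)\<^sup>2 * (1 - exp (- (real k * h)) * (1 + real k * h))" if h: "0 < h" for h
    proof -
      define I where "I = insert None (Some ` ?V)"
      have finI: "finite I" using fin by (simp add: I_def)
      \<comment> \<open>Up to a null event, \<open>R\<close> means that at least two jumps occur by
        time \<open>h\<close>.\<close>
      define R where "R = space \<Omega> - (\<Union>c\<in>I. jump_event h c)"
      have ev[measurable]: "jump_event h c \<in> sets \<Omega>" for c using jump_event_sets fin h by blast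
      have R[measurable]: "R \<in> sets \<Omega>" using finI by (auto simp: R_def)
      have disj: "disjoint_family_on (jump_event h) I"
        using jump_event_disjoint by (auto simp: disjoint_family_on_def I_def)
      have sumI: "(\<Sum>c\<in>I. (if c = None then 1 else h) * exp (- (real k * h)) * g c)
          = exp (- (real k * h)) * (g None + h * (\<Sum>v\<in>?V. g (Some v)))" for g :: "int option \<Rightarrow> real"
        using fin by (simp add: I_def sum.reindex sum_distrib_left algebra_simps)
      have "prob (\<Union>c\<in>I. jump_event h c) = (\<Sum>c\<in>I. prob (jump_event h c))"
        using finI disj by (intro finite_measure_finite_Union) auto
      also have "\<dots> = (\<Sum>c\<in>I. (if c = None then 1 else h) * exp (- (real k * h)) * 1)"
        using prob_jump_event[OF fin h] card by (intro sum.cong) (auto simp: I_def)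
      also have "\<dots> = exp (- (real k * h)) * (1 + real k * h)"
        unfolding sumI by (simp add: card mult.commute)
      finally have PR: "prob R = 1 - exp (- (real k * h)) * (1 + real k * h)"
        using finI prob_compl[of "\<Union>c\<in>I. jump_event h c"] unfolding R_def by auto
      have split: "AE \<omega> in \<Omega>. f (?c h \<omega>)
          = (\<Sum>c\<in>I. indicator (jump_event h c) \<omega> * T c (?c 0 \<omega>)) + indicator R \<omega> * f (?c h \<omega>)"
        using AE_meteor_path AE_counting_paths[OF countable_finite[OF fin]] AE_space
      proof eventually_elim
        case (elim \<omega>)
        then have path: "meteor_path ?V (circle_adj k) (\<lambda>v s. N v s \<omega>) (\<lambda>v s. M v s \<omega>)"
          and counting: "\<And>y. y \<in> ?V \<Longrightarrow> counting_path (\<lambda>s. N y s \<omega>)" by auto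
        show ?case
        proof (cases "\<omega> \<in> R")
          case True
          then show ?thesis by (simp add: R_def indicator_def)
        next
          case False
          then obtain d where d: "d \<in> I" "\<omega> \<in> jump_event h d" using elim by (auto simp: R_def)
          have "f (?c h \<omega>) = T d (?c 0 \<omega>)"
          proof (cases d)
            case None
            then have "M x h \<omega> = M x 0 \<omega>" if "x \<in> ?V" for x
              using circle_no_jump[OF path counting less_imp_le[OF h] that] d(2) by (simp add: jump_event_iff)
            then show ?thesis using None u w by (simp add: T_def f_def)
          next
            case (Some v)
            then have v: "v \<in> ?V" using d by (auto simp: I_def)
            have "M x h \<omega> = M x 0 \<omega> + ?lap x v * M v 0 \<omega>" if "x \<in> ?V" for x
              using circle_one_jump[OF k path counting less_imp_le[OF h] v that] d(2) Some
              by (simp add: jump_event_iff)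
            then show ?thesis using Some u w v by (simp add: T_def f_def)
          qed
          moreover have "indicator (jump_event h c) \<omega> * T c (?c 0 \<omega>) = (if c = d then T d (?c 0 \<omega>) else 0)"
            if "c \<in> I" for c
            using d that disj by (auto simp: disjoint_family_on_def indicator_def)
          ultimately show ?thesis using False d finI by simp
        qed
      qed
      have int_f: "integrable \<Omega> (\<lambda>\<omega>. f (?c h \<omega>))"
        using bounded_t[of h] h by (intro integrable_const_bound[where B="(real k)\<^sup>2"]) (auto dest: f_bd elim!: eventually_mono)
      have int_R: "integrable \<Omega> (\<lambda>\<omega>. indicator R \<omega> * f (?c h \<omega>))"
        using integrable_mult_indicator[OF R int_f] by simp
      have T_bd: "\<bar>T c m\<bar> \<le> (2 * real k)\<^sup>2" if "circle_bounded k m" "c \<in> I" for c m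
      proof -
        have lap_bd: "\<bar>m x + ?lap x v * m v\<bar> \<le> 2 * real k" if "x \<in> ?V" "v \<in> ?V" for x v
        proof -
          have "\<bar>?lap x v * m v\<bar> \<le> 1 * real k"
            unfolding abs_mult using \<open>circle_bounded k m\<close> that
            by (intro mult_mono) (auto simp: circle_lap_def circle_bounded_def)
          moreover have "\<bar>m x\<bar> \<le> real k" using \<open>circle_bounded k m\<close> that by (auto simp: circle_bounded_def)
          ultimately show ?thesis by linarith
        qed
        have "f m \<le> (2 * real k)\<^sup>2" using f_bd[OF that(1)] by (simp add: power_mult_distrib)
        then show ?thesis
        proof (cases c)
          case None
          then show ?thesis using f_bd[OF that(1)] \<open>f m \<le> _\<close> by (simp add: T_def)
        next
          case (Some v)
          then have "v \<in> ?V" using that(2) by (auto simp: I_def)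
          then have "\<bar>m u + ?lap u v * m v\<bar> * \<bar>m w + ?lap w v * m v\<bar> \<le> (2 * real k) * (2 * real k)"
            using u w by (intro mult_mono lap_bd) auto
          then show ?thesis by (simp add: Some T_def abs_mult power2_eq_square)
        qed
      qed
      have int_T: "integrable \<Omega> (\<lambda>\<omega>. indicator (jump_event h c) \<omega> * T c (?c 0 \<omega>))" if "c \<in> I" for c
      proof -
        have [measurable]: "T c \<in> borel_measurable ?P" using that by (intro meas_T) (simp add: I_def)
        have "integrable \<Omega> (\<lambda>\<omega>. T c (?c 0 \<omega>))"
          using bounded_t[of 0] that
          by (intro integrable_const_bound[where B="(2 * real k)\<^sup>2"]) (auto dest: T_bd elim!: eventually_mono)
        from integrable_mult_indicator[OF ev[of c] this] show ?thesis by simp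
      qed
      have "q = (\<integral>\<omega>. f (?c h \<omega>) \<partial>\<Omega>)"
        unfolding q_def law[OF less_imp_le[OF h], symmetric] config_law_def
        by (rule integral_distr[OF measurable_config[OF less_imp_le[OF h]] meas_f])
      also have "\<dots> = (\<integral>\<omega>. (\<Sum>c\<in>I. indicator (jump_event h c) \<omega> * T c (?c 0 \<omega>)) + indicator R \<omega> * f (?c h \<omega>) \<partial>\<Omega>)"
        using split int_f int_R int_T by (intro integral_cong_AE borel_measurable_integrable) auto
      also have "\<dots> = (\<Sum>c\<in>I. \<integral>\<omega>. indicator (jump_event h c) \<omega> * T c (?c 0 \<omega>) \<partial>\<Omega>)
          + (\<integral>\<omega>. indicator R \<omega> * f (?c h \<omega>) \<partial>\<Omega>)"
        using int_R int_T by simp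
      also have "(\<Sum>c\<in>I. \<integral>\<omega>. indicator (jump_event h c) \<omega> * T c (?c 0 \<omega>) \<partial>\<Omega>)
          = (\<Sum>c\<in>I. (if c = None then 1 else h) * exp (- (real k * h)) * (\<integral>m. T c m \<partial>Q))"
      proof (rule sum.cong[OF refl])
        fix c assume "c \<in> I"
        then have c: "c \<in> insert None (Some ` ?V)" by (simp add: I_def)
        have "AE m in config_law \<Omega> ?V M 0. 0 \<le> T c m"
          using bounded c law[of 0] by (auto dest: T_pos elim!: eventually_mono)
        from integral_jump_event[OF fin h c meas_T[OF c] this]
        show "(\<integral>\<omega>. indicator (jump_event h c) \<omega> * T c (?c 0 \<omega>) \<partial>\<Omega>)
            = (if c = None then 1 else h) * exp (- (real k * h)) * (\<integral>m. T c m \<partial>Q)"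
          using law[of 0] card by simp
      qed
      also have "\<dots> = exp (- (real k * h)) * (q + h * s)"
        by (simp add: sumI s_def q_def T_def)
      finally have q: "q - exp (- (real k * h)) * (q + h * s) = (\<integral>\<omega>. indicator R \<omega> * f (?c h \<omega>) \<partial>\<Omega>)"
        by linarith
      have AE_R: "AE \<omega> in \<Omega>. 0 \<le> indicator R \<omega> * f (?c h \<omega>) \<and> indicator R \<omega> * f (?c h \<omega>) \<le> (real k)\<^sup>2 * indicator R \<omega>"
        using bounded_t[OF less_imp_le[OF h]] by eventually_elim (auto dest: f_bd split: split_indicator)
      have "0 \<le> (\<integral>\<omega>. indicator R \<omega> * f (?c h \<omega>) \<partial>\<Omega>)"
        using AE_R by (intro integral_nonneg_AE) auto
      moreover have "(\<integral>\<omega>. indicator R \<omega> * f (?c h \<omega>) \<partial>\<Omega>) \<le> (\<integral>\<omega>. (real k)\<^sup>2 * indicator R \<omega> \<partial>\<Omega>)"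
      proof (rule integral_mono_AE[OF int_R])
        show "integrable \<Omega> (\<lambda>\<omega>. (real k)\<^sup>2 * indicator R \<omega>)"
          by (intro integrable_const_bound[where B="(real k)\<^sup>2"]) (auto simp: indicator_def)
      qed (use AE_R in auto)
      ultimately show ?thesis unfolding q using PR by simp
    qed
    \<comment> \<open>Equivalently, the changes of the mean of \<open>f\<close>, summed over the
      \<open>k\<close> possible jumps, vanish; expanding \<open>T\<close> below turns this into the
      invariance equation.\<close>
    then have "s = real k * q" by (rule first_order_balance)
    note bdi = integrable_circle_product[OF \<open>prob_space Q\<close> sets_Q bounded]
    have "(\<integral>m. T (Some v) m \<partial>Q) = q + (?lap u v * (\<integral>m. m v * m w \<partial>Q) + ?lap w v * (\<integral>m. m u * m v \<partial>Q)
        + ?lap u v * ?lap w v * (\<integral>m. m v * m v \<partial>Q))" if v: "v \<in> ?V" for v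
    proof -
      have "T (Some v) = (\<lambda>m. m u * m w + (?lap u v * (m v * m w) + ?lap w v * (m u * m v) + ?lap u v * ?lap w v * (m v * m v)))"
        by (simp add: T_def fun_eq_iff algebra_simps)
      then show ?thesis using bdi u w v by (simp add: q_def f_def)
    qed
    then have "s = (\<Sum>v\<in>?V. q + (?lap u v * (\<integral>m. m v * m w \<partial>Q) + ?lap w v * (\<integral>m. m u * m v \<partial>Q)
        + ?lap u v * ?lap w v * (\<integral>m. m v * m v \<partial>Q)))"
      by (simp add: s_def)
    then show "(\<Sum>v\<in>?V. ?lap u v * (\<integral>m. m v * m w \<partial>Q) + ?lap w v * (\<integral>m. m u * m v \<partial>Q)
        + ?lap u v * ?lap w v * (\<integral>m. m v * m v \<partial>Q)) = 0"
      using \<open>s = real k * q\<close> card by (simp add: sum.distrib[of "\<lambda>_. q"])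
  qed
qed

section \<open>The two-point function and its quadratic form\<close>

lemma integral_double_sum:
  fixes F :: "'i \<Rightarrow> 'j \<Rightarrow> 'a \<Rightarrow> real"
  assumes "\<And>x y. x \<in> A \<Longrightarrow> y \<in> B \<Longrightarrow> integrable Q (F x y)"
  shows "(\<integral>m. (\<Sum>x\<in>A. \<Sum>y\<in>B. F x y m) \<partial>Q) = (\<Sum>x\<in>A. \<Sum>y\<in>B. \<integral>m. F x y m \<partial>Q)"
proof -
  have "(\<integral>m. (\<Sum>x\<in>A. \<Sum>y\<in>B. F x y m) \<partial>Q) = (\<Sum>x\<in>A. \<integral>m. (\<Sum>y\<in>B. F x y m) \<partial>Q)"
    by (intro Bochner_Integration.integral_sum Bochner_Integration.integrable_sum assms)
  also have "\<dots> = (\<Sum>x\<in>A. \<Sum>y\<in>B. \<integral>m. F x y m \<partial>Q)"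
    by (intro sum.cong refl Bochner_Integration.integral_sum assms)
  finally show ?thesis .
qed

text \<open>Uniqueness applies because the two-point function sums to the mean of the squared total
  mass, which is the constant \<open>k\<^sup>2\<close>.\<close>

lemma circle_second_moment:
  assumes k: "3 \<le> k" and Q: "circle_stationary TYPE('w) k Q"
    and u: "u \<in> circle_vertices k" and w: "w \<in> circle_vertices k"
  shows "integrable Q (\<lambda>m. m u * m w)" "(\<integral>m. m u * m w \<partial>Q) = 1 - circle_lap k u w"
proof -
  note Q' = circle_stationary_invariant[OF k Q]
  let ?V = "circle_vertices k"
  interpret prob_space Q by (rule Q'(1))
  note int = integrable_circle_product[OF Q'(1-3)]
  show "integrable Q (\<lambda>m. m u * m w)" by (rule int[OF u w])
  have "(\<Sum>u\<in>?V. \<Sum>w\<in>?V. \<integral>m. m u * m w \<partial>Q) = (\<integral>m. (\<Sum>u\<in>?V. \<Sum>w\<in>?V. m u * m w) \<partial>Q)"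
    by (rule integral_double_sum[symmetric]) (rule int)
  also have "\<dots> = (\<integral>m. (real k)\<^sup>2 \<partial>Q)"
  proof (rule integral_cong_AE)
    show "AE m in Q. (\<Sum>u\<in>?V. \<Sum>w\<in>?V. m u * m w) = (real k)\<^sup>2"
      using Q'(3) by eventually_elim (simp add: circle_bounded_def power2_eq_square flip: sum_product)
  qed (auto intro!: borel_measurable_sum borel_measurable_integrable int)
  also have "\<dots> = (real k)\<^sup>2" by (simp add: prob_space)
  finally show "(\<integral>m. m u * m w \<partial>Q) = 1 - circle_lap k u w"
    by (rule circle_invariant_unique[OF k Q'(4) _ u w])
qed

text \<open>Summation by parts; no boundary terms appear because \<open>g\<close> vanishes at both
  ends of the window.\<close>

lemma gradient_sum:
  fixes g :: "int \<Rightarrow> real"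
  assumes g: "\<And>x. x \<notin> {-L<..<L} \<Longrightarrow> g x = 0"
  shows "(\<Sum>x\<in>{-L..L}. g x * (g (x - 1) / 2 + g (x + 1) / 2 - g x)) = - (\<Sum>x\<in>{-L..<L}. (g (x + 1) - g x)\<^sup>2) / 2"
proof -
  have shift: "(\<Sum>x\<in>{-L..<L}. f (x + 1)) = (\<Sum>x\<in>{-L..L}. f x)" if "f (-L) = 0" for f :: "int \<Rightarrow> real"
  proof -
    have "(\<Sum>x\<in>{-L..<L}. f (x + 1)) = (\<Sum>x\<in>{-L<..L}. f x)"
      by (rule sum.reindex_bij_witness[of _ "\<lambda>x. x - 1" "\<lambda>x. x + 1"]) auto
    also have "\<dots> = (\<Sum>x\<in>{-L..L}. f x)"
      using that by (intro sum.mono_neutral_left) (auto simp: order_less_le)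
    finally show ?thesis .
  qed
  have drop: "(\<Sum>x\<in>{-L..<L}. f x) = (\<Sum>x\<in>{-L..L}. f x)" if "f L = 0" for f :: "int \<Rightarrow> real"
    using that by (intro sum.mono_neutral_left) (auto simp: order_less_le)
  have "(\<Sum>x\<in>{-L..<L}. (g (x + 1) - g x)\<^sup>2)
      = (\<Sum>x\<in>{-L..<L}. (g (x + 1))\<^sup>2) + (\<Sum>x\<in>{-L..<L}. (g x)\<^sup>2) - 2 * (\<Sum>x\<in>{-L..<L}. g (x + 1) * g x)"
    by (simp add: power2_diff sum.distrib sum_subtractf sum_distrib_left mult.assoc)
  also have "(\<Sum>x\<in>{-L..<L}. (g (x + 1))\<^sup>2) = (\<Sum>x\<in>{-L..L}. (g x)\<^sup>2)"
    by (rule shift) (simp add: g)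
  also have "(\<Sum>x\<in>{-L..<L}. (g x)\<^sup>2) = (\<Sum>x\<in>{-L..L}. (g x)\<^sup>2)"
    by (rule drop) (simp add: g)
  finally have grad: "(\<Sum>x\<in>{-L..<L}. (g (x + 1) - g x)\<^sup>2)
      = 2 * (\<Sum>x\<in>{-L..L}. (g x)\<^sup>2) - 2 * (\<Sum>x\<in>{-L..<L}. g (x + 1) * g x)"
    by simp
  have "(\<Sum>x\<in>{-L..L}. g x * g (x - 1)) = (\<Sum>x\<in>{-L..<L}. g (x + 1) * g x)"
    using shift[of "\<lambda>x. g x * g (x - 1)"] by (simp add: g)
  moreover have "(\<Sum>x\<in>{-L..L}. g x * g (x + 1)) = (\<Sum>x\<in>{-L..<L}. g (x + 1) * g x)"
    using drop[of "\<lambda>x. g x * g (x + 1)"] by (simp add: g mult.commute)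
  ultimately have "(\<Sum>x\<in>{-L..L}. g x * (g (x - 1) / 2 + g (x + 1) / 2 - g x))
      = (\<Sum>x\<in>{-L..<L}. g (x + 1) * g x) - (\<Sum>x\<in>{-L..L}. (g x)\<^sup>2)"
    by (simp add: algebra_simps power2_eq_square sum.distrib sum_subtractf flip: sum_divide_distrib)
  then show ?thesis unfolding grad by simp
qed

text \<open>The constant part of \<open>1 - circle_lap\<close> yields the squared sum and the
  Laplacian part yields the gradient term. The bounds on \<open>c\<close> keep the shifted window
  within 1 to \<open>k - 1\<close>, so the closing edge of the circle never joins two of its
  sites.\<close>

lemma circle_quadratic_form:
  fixes g :: "int \<Rightarrow> real" and c :: int
  assumes k: "3 \<le> k" and Q: "circle_stationary TYPE('w) k Q" and L: "L < c" "2 * c \<le> int k"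
    and g: "\<And>x. x \<notin> {-L<..<L} \<Longrightarrow> g x = 0"
  defines "q \<equiv> \<lambda>m. (\<Sum>x\<in>{-L..L}. g x * m (x + c))\<^sup>2"
  shows "integrable Q q"
    "integral\<^sup>L Q q = (\<Sum>x\<in>{-L..<L}. (g (x + 1) - g x)\<^sup>2) / 2 + (\<Sum>x\<in>{-L..L}. g x)\<^sup>2"
proof -
  let ?B = "{-L..L}"
  have V: "x + c \<in> circle_vertices k" if "x \<in> ?B" for x
    using that L by (auto simp: circle_vertices_def)
  have q: "q m = (\<Sum>x\<in>?B. \<Sum>y\<in>?B. g x * g y * (m (x + c) * m (y + c)))" for m
    unfolding q_def power2_eq_square sum_product by (intro sum.cong refl) simp
  have int: "integrable Q (\<lambda>m. g x * g y * (m (x + c) * m (y + c)))" if "x \<in> ?B" "y \<in> ?B" for x y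
    using circle_second_moment(1)[OF k Q V V] that by simp
  show "integrable Q q"
    unfolding q using int by (intro Bochner_Integration.integrable_sum)
  have "integral\<^sup>L Q q = (\<Sum>x\<in>?B. \<Sum>y\<in>?B. g x * g y * (1 - circle_lap k (x + c) (y + c)))"
  proof -
    have "integral\<^sup>L Q q = (\<Sum>x\<in>?B. \<Sum>y\<in>?B. \<integral>m. g x * g y * (m (x + c) * m (y + c)) \<partial>Q)"
      unfolding q by (rule integral_double_sum) (rule int)
    then show ?thesis
      using circle_second_moment(2)[OF k Q V V] by simp
  qed
  also have "\<dots> = (\<Sum>x\<in>?B. \<Sum>y\<in>?B. g x * g y) - (\<Sum>x\<in>?B. g x * (\<Sum>y\<in>?B. g y * circle_lap k (x + c) (y + c)))"
    by (simp add: algebra_simps sum_subtractf sum_distrib_left)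
  also have "(\<Sum>x\<in>?B. \<Sum>y\<in>?B. g x * g y) = (\<Sum>x\<in>?B. g x)\<^sup>2"
    by (simp add: power2_eq_square sum_product)
  also have "(\<Sum>x\<in>?B. g x * (\<Sum>y\<in>?B. g y * circle_lap k (x + c) (y + c)))
      = (\<Sum>x\<in>?B. g x * (g (x - 1) / 2 + g (x + 1) / 2 - g x))"
  proof (rule sum.cong[OF refl])
    fix x assume "x \<in> ?B"
    show "g x * (\<Sum>y\<in>?B. g y * circle_lap k (x + c) (y + c)) = g x * (g (x - 1) / 2 + g (x + 1) / 2 - g x)"
    proof (cases "x \<in> {-L<..<L}")
      case True
      have "g y * circle_lap k (x + c) (y + c) = (if y = x then - g x else 0)
          + (if y = x - 1 then g (x - 1) / 2 else 0) + (if y = x + 1 then g (x + 1) / 2 else 0)" if "y \<in> ?B" for y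
      proof (cases "y \<in> {-L<..<L}")
        case y: True
        then show ?thesis using True L by (auto simp: circle_lap_def circle_adj_def)
      next
        case False
        then show ?thesis using True by (auto simp: g)
      qed
      then have "(\<Sum>y\<in>?B. g y * circle_lap k (x + c) (y + c)) = (\<Sum>y\<in>?B. (if y = x then - g x else 0)
          + (if y = x - 1 then g (x - 1) / 2 else 0) + (if y = x + 1 then g (x + 1) / 2 else 0))"
        by (rule sum.cong[OF refl])
      also have "\<dots> = g (x - 1) / 2 + g (x + 1) / 2 - g x"
        using True by (simp add: sum.distrib)
      finally show ?thesis by simp
    qed (simp add: g)
  qed
  finally show "integral\<^sup>L Q q = (\<Sum>x\<in>{-L..<L}. (g (x + 1) - g x)\<^sup>2) / 2 + (\<Sum>x\<in>{-L..L}. g x)\<^sup>2"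
    using gradient_sum[of L g, OF g] by linarith
qed

section \<open>Passage to the weak limit\<close>

lemma periodic_extension_near:
  assumes "L < int (k div 2)" "x \<in> {-L..L}"
  shows "periodic_extension k m x = m (x + int (k div 2))"
proof -
  have "(x + int (k div 2) - 1) mod int k = x + int (k div 2) - 1"
    using assms by (intro mod_pos_pos_trivial) auto
  then show ?thesis by (simp add: periodic_extension_def)
qed

lemma measurable_periodic_extension:
  assumes "0 < k" "sets Q = sets (Pi\<^sub>M (circle_vertices k) (\<lambda>_. borel :: real measure))"
  shows "periodic_extension k \<in> measurable Q (Pi\<^sub>M UNIV (\<lambda>_. borel))"
proof -
  have "periodic_extension k \<in> measurable (Pi\<^sub>M (circle_vertices k) (\<lambda>_. borel)) (Pi\<^sub>M UNIV (\<lambda>_. borel))"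
    unfolding periodic_extension_def[abs_def]
  proof (rule measurable_PiM_single')
    fix x :: int
    have "(x + int (k div 2) - 1) mod int k + 1 \<in> circle_vertices k"
      using circle_site_in[OF assms(1), of "x + int (k div 2)"] by (simp add: circle_site_def)
    then show "(\<lambda>m. m ((x + int (k div 2) - 1) mod int k + 1)) \<in> borel_measurable (Pi\<^sub>M (circle_vertices k) (\<lambda>_. borel))"
      by (rule measurable_component_singleton)
  qed auto
  then show ?thesis using measurable_cong_sets[OF assms(2) refl] by blast
qed

text \<open>Weak convergence only tests bounded functions, so the square is truncated at
  \<open>i\<close>; it is continuous because it involves finitely many coordinates. Each truncation
  inherits the bound from the circles, and monotone convergence removes the truncation.\<close>

lemma weak_limit_quadratic_bound:
  fixes g :: "int \<Rightarrow> real"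
  assumes Q: "\<And>k. 3 \<le> k \<Longrightarrow> circle_stationary TYPE('c) k (Q k)"
    and Q_inf: "weakly_converges (\<lambda>k. periodic_law k (Q k)) Q_inf"
    and g: "\<And>x. x \<notin> {-L<..<L} \<Longrightarrow> g x = 0"
  shows "(\<integral>\<^sup>+m. ennreal ((\<Sum>x\<in>{-L..L}. g x * m x)\<^sup>2) \<partial>Q_inf)
    \<le> ennreal ((\<Sum>x\<in>{-L..<L}. (g (x + 1) - g x)\<^sup>2) / 2 + (\<Sum>x\<in>{-L..L}. g x)\<^sup>2)"
proof -
  define \<Phi> where "\<Phi> = (\<Sum>x\<in>{-L..<L}. (g (x + 1) - g x)\<^sup>2) / 2 + (\<Sum>x\<in>{-L..L}. g x)\<^sup>2"
  define f where "f i m = min ((\<Sum>x\<in>{-L..L}. g x * m x)\<^sup>2) (real i)" for i and m :: "int \<Rightarrow> real"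
  have f_nonneg: "0 \<le> f i m" for i m by (simp add: f_def)
  have f_le: "f i m \<le> real i" for i m by (simp add: f_def)
  have cont: "continuous_on UNIV (f i)" for i
    unfolding f_def by (intro continuous_intros continuous_on_product_coordinates)
  interpret prob_space Q_inf using Q_inf by (simp add: weakly_converges_def)
  have sets: "sets Q_inf = sets borel" using Q_inf by (simp add: weakly_converges_def)
  have meas: "f i \<in> borel_measurable Q_inf" for i
    using borel_measurable_continuous_onI[OF cont] measurable_cong_sets[OF sets refl] by blast
  have int: "integrable Q_inf (f i)" for i
    by (rule integrable_const_bound[where B="real i"]) (use meas f_nonneg f_le in auto)
  have le: "integral\<^sup>L Q_inf (f i) \<le> \<Phi>" for i
  proof (rule LIMSEQ_le_const2)
    have "bounded (range (f i))"
      unfolding bounded_iff using f_nonneg f_le by (intro exI[of _ "real i"]) auto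
    then show "(\<lambda>k. integral\<^sup>L (periodic_law k (Q k)) (f i)) \<longlonglongrightarrow> integral\<^sup>L Q_inf (f i)"
      using Q_inf cont by (simp add: weakly_converges_def)
    have "integral\<^sup>L (periodic_law k (Q k)) (f i) \<le> \<Phi>" if "3 \<le> k" "L < int (k div 2)" for k
    proof -
      let ?q = "\<lambda>m. (\<Sum>x\<in>{-L..L}. g x * m (x + int (k div 2)))\<^sup>2"
      note sets_Q = circle_stationary_invariant(2)[OF that(1) Q[OF that(1)]]
      have [measurable]: "f i \<in> borel_measurable (Pi\<^sub>M UNIV (\<lambda>_. borel))"
        unfolding f_def by measurable
      have per[measurable]: "periodic_extension k \<in> measurable (Q k) (Pi\<^sub>M UNIV (\<lambda>_. borel))"
        by (rule measurable_periodic_extension[OF _ sets_Q]) (use that in simp)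
      have "integral\<^sup>L (periodic_law k (Q k)) (f i) = (\<integral>m. f i (periodic_extension k m) \<partial>Q k)"
        unfolding periodic_law_def by (rule integral_distr) measurable
      also have "\<dots> \<le> integral\<^sup>L (Q k) ?q"
      proof (rule integral_mono)
        interpret Qk: prob_space "Q k" by (rule circle_stationary_invariant(1)[OF that(1) Q[OF that(1)]])
        show "integrable (Q k) (\<lambda>m. f i (periodic_extension k m))"
          using f_nonneg f_le by (intro Qk.integrable_const_bound[where B="real i"]) auto
        show "f i (periodic_extension k m) \<le> ?q m" for m
          using periodic_extension_near[OF that(2)] by (simp add: f_def)
      qed (rule circle_quadratic_form(1)[OF that(1) Q[OF that(1)] that(2) _ g], simp)
      also have "\<dots> = \<Phi>"
        unfolding \<Phi>_def by (rule circle_quadratic_form(2)[OF that(1) Q[OF that(1)] that(2) _ g]) simp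
      finally show ?thesis .
    qed
    \<comment> \<open>The threshold guarantees both \<open>3 \<le> k\<close> and
      \<open>L < int (k div 2)\<close>.\<close>
    then show "\<exists>n. \<forall>k\<ge>n. integral\<^sup>L (periodic_law k (Q k)) (f i) \<le> \<Phi>"
      by (intro exI[of _ "2 * nat \<bar>L\<bar> + 3"]) auto
  qed
  have "ennreal ((\<Sum>x\<in>{-L..L}. g x * m x)\<^sup>2) = (SUP i. ennreal (f i m))" for m
  proof (rule antisym)
    obtain i where "(\<Sum>x\<in>{-L..L}. g x * m x)\<^sup>2 \<le> real i" using real_arch_simple by blast
    then have "(\<Sum>x\<in>{-L..L}. g x * m x)\<^sup>2 = f i m" by (simp add: f_def)
    then show "ennreal ((\<Sum>x\<in>{-L..L}. g x * m x)\<^sup>2) \<le> (SUP i. ennreal (f i m))"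
      by (intro SUP_upper2[of i]) auto
  qed (auto intro!: SUP_least ennreal_leI simp: f_def)
  then have "(\<integral>\<^sup>+m. ennreal ((\<Sum>x\<in>{-L..L}. g x * m x)\<^sup>2) \<partial>Q_inf) = (\<integral>\<^sup>+m. (SUP i. ennreal (f i m)) \<partial>Q_inf)"
    by simp
  also have "\<dots> = (SUP i. \<integral>\<^sup>+m. ennreal (f i m) \<partial>Q_inf)"
  proof (rule nn_integral_monotone_convergence_SUP)
    show "incseq (\<lambda>i m. ennreal (f i m))"
      by (auto simp: incseq_def le_fun_def f_def intro!: ennreal_leI min.mono)
    show "(\<lambda>m. ennreal (f i m)) \<in> borel_measurable Q_inf" for i
      using meas[of i] by simp
  qed
  also have "\<dots> \<le> ennreal \<Phi>"
  proof (rule SUP_least)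
    show "(\<integral>\<^sup>+m. ennreal (f i m) \<partial>Q_inf) \<le> ennreal \<Phi>" for i
      using nn_integral_eq_integral[OF int[of i]] f_nonneg le[of i] by (simp add: ennreal_leI)
  qed
  finally show ?thesis by (simp add: \<Phi>_def)
qed

section \<open>Variance bounds by approximation on large events\<close>

lemma borel_measurable_completion_AE:
  fixes f g :: "'a \<Rightarrow> real"
  assumes g: "g \<in> borel_measurable M" and eq: "AE x in M. f x = g x"
  shows "f \<in> borel_measurable (completion M)"
proof (rule measurableI)
  fix A :: "real set" assume A: "A \<in> sets borel"
  show "f -` A \<inter> space (completion M) \<in> sets (completion M)"
  proof (rule completion.in_sets_AE)
    show "AE x in completion M. (x \<in> g -` A \<inter> space M) = (x \<in> f -` A \<inter> space (completion M))"
      using AE_completion[OF eq] by eventually_elim auto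
    show "g -` A \<inter> space M \<in> sets (completion M)"
      using measurable_sets[OF g A] by auto
  qed auto
qed simp

text \<open>The complements of the \<open>A j\<close> have summable probabilities, so by
  Borel-Cantelli almost every point has \<open>G j x = F x\<close> for all large \<open>j\<close>.
  The limit \<open>F'\<close> is thus a measurable version of \<open>F\<close>, which makes
  \<open>F\<close> measurable on the completion, and Fatou transfers the second moment bound, which
  dominates the variance.\<close>

lemma (in prob_space) variance_bound_approximation:
  fixes F :: "'a \<Rightarrow> real" and G :: "nat \<Rightarrow> 'a \<Rightarrow> real"
  assumes G[measurable]: "\<And>j. G j \<in> borel_measurable M" and C: "0 \<le> C"
    and bound: "\<And>j. (\<integral>\<^sup>+x. ennreal ((G j x)\<^sup>2) \<partial>M) \<le> ennreal C"
    and A[measurable]: "\<And>j. A j \<in> events" and prob_A: "\<And>j. 1 - (1 / 2) ^ j \<le> prob (A j)"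
    and F: "\<And>j. AE x in M. x \<in> A j \<longrightarrow> F x = G j x"
  shows "integrable (completion M) F \<and> integrable (completion M) (\<lambda>x. (F x)\<^sup>2) \<and>
    prob_space.variance (completion M) F \<le> C"
proof -
  have "AE x in M. eventually (\<lambda>j. x \<in> space M - (space M - A j)) sequentially"
  proof (rule borel_cantelli_AE1)
    have "prob (space M - A j) \<le> (1 / 2) ^ j" for j
      using prob_A[of j] prob_compl[OF A[of j]] by simp
    then show "summable (\<lambda>j. prob (space M - A j))"
      by (intro summable_comparison_test'[OF summable_geometric[of "1 / 2 :: real"]]) auto
  qed (auto simp: emeasure_eq_measure)
  moreover have "AE x in M. \<forall>j. x \<in> A j \<longrightarrow> F x = G j x"
    using F by (simp add: AE_all_countable)
  ultimately have conv: "AE x in M. eventually (\<lambda>j. G j x = F x) sequentially"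
    by eventually_elim (auto elim: eventually_mono)
  define F' where "F' x = lim (\<lambda>j. G j x)" for x
  have meas[measurable]: "F' \<in> borel_measurable M"
    unfolding F'_def by (rule borel_measurable_lim_metric) (rule G)
  have eq: "AE x in M. F x = F' x"
    using conv
  proof eventually_elim
    case (elim x)
    then have "(\<lambda>j. G j x) \<longlonglongrightarrow> F x" by (rule tendsto_eventually)
    then show ?case by (simp add: F'_def limI)
  qed
  have "(\<integral>\<^sup>+x. ennreal ((F' x)\<^sup>2) \<partial>M) \<le> (\<integral>\<^sup>+x. liminf (\<lambda>j. ennreal ((G j x)\<^sup>2)) \<partial>M)"
  proof (rule nn_integral_mono_AE)
    show "AE x in M. ennreal ((F' x)\<^sup>2) \<le> liminf (\<lambda>j. ennreal ((G j x)\<^sup>2))"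
      using conv eq
    proof eventually_elim
      case (elim x)
      then have "eventually (\<lambda>j. ennreal ((G j x)\<^sup>2) = ennreal ((F' x)\<^sup>2)) sequentially"
        by (auto elim: eventually_mono)
      then have "(\<lambda>j. ennreal ((G j x)\<^sup>2)) \<longlonglongrightarrow> ennreal ((F' x)\<^sup>2)"
        by (rule tendsto_eventually)
      from lim_imp_Liminf[OF sequentially_bot this] show ?case by simp
    qed
  qed
  also have "\<dots> \<le> liminf (\<lambda>j. \<integral>\<^sup>+x. ennreal ((G j x)\<^sup>2) \<partial>M)"
    by (rule nn_integral_liminf) measurable
  also have "\<dots> \<le> ennreal C"
    using bound by (intro Liminf_le) auto
  finally have F'_bound: "(\<integral>\<^sup>+x. ennreal ((F' x)\<^sup>2) \<partial>M) \<le> ennreal C" .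
  then have "(\<integral>\<^sup>+x. ennreal ((F' x)\<^sup>2) \<partial>M) < \<infinity>"
    by (auto simp: less_top[symmetric] top_unique)
  then have int_sq: "integrable M (\<lambda>x. (F' x)\<^sup>2)"
    by (intro integrableI_nonneg) auto
  have int: "integrable M F'"
    by (rule square_integrable_imp_integrable[OF meas int_sq])
  have sq_le: "expectation (\<lambda>x. (F' x)\<^sup>2) \<le> C"
    using F'_bound nn_integral_eq_integral[OF int_sq] C by simp
  interpret comp: prob_space "completion M" by (rule prob_space_completion)
  have F_meas[measurable]: "F \<in> borel_measurable (completion M)"
    by (rule borel_measurable_completion_AE[OF meas eq])
  have F'_meas[measurable]: "F' \<in> borel_measurable (completion M)"
    using measurable_completion[OF meas] .
  note eq' = AE_completion[OF eq]
  have eq_sq: "AE x in completion M. (F x)\<^sup>2 = (F' x)\<^sup>2"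
    using eq' by eventually_elim simp
  have F_int: "integrable (completion M) F"
    using int integrable_cong_AE[OF F_meas F'_meas eq'] integrable_completion[OF meas] by simp
  have F_sq: "integrable (completion M) (\<lambda>x. (F x)\<^sup>2)"
    using int_sq integrable_cong_AE[OF _ _ eq_sq] integrable_completion[of "\<lambda>x. (F' x)\<^sup>2" M] by simp
  have "comp.variance F = comp.expectation (\<lambda>x. (F x)\<^sup>2) - (comp.expectation F)\<^sup>2"
    by (rule comp.variance_eq[OF F_int F_sq])
  also have "\<dots> \<le> comp.expectation (\<lambda>x. (F x)\<^sup>2)" by simp
  also have "\<dots> = comp.expectation (\<lambda>x. (F' x)\<^sup>2)"
    by (rule integral_cong_AE[OF _ _ eq_sq]) auto
  also have "\<dots> = expectation (\<lambda>x. (F' x)\<^sup>2)"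
    by (rule integral_completion) measurable
  finally show ?thesis using F_int F_sq sq_le by simp
qed

section \<open>Weights of jump sequences\<close>

text \<open>A silent site on each side of 0 and 1 shields the flow from all masses beyond.\<close>

definition blocked :: "int \<Rightarrow> int option list \<Rightarrow> bool" where
  "blocked L as \<longleftrightarrow> (\<exists>a b. - L \<le> a \<and> a < 0 \<and> 1 < b \<and> b \<le> L \<and> Some a \<notin> set as \<and> Some b \<notin> set as)"

definition jump_lists :: "int \<Rightarrow> nat \<Rightarrow> int option list set" where
  "jump_lists L m = {as. set as \<subseteq> insert None (Some ` {-L..L}) \<and> length as = m}"

lemma finite_jump_lists: "finite (jump_lists L m)"
  unfolding jump_lists_def by (intro finite_lists_length_eq) auto

lemma flow_coeff_blocked: "blocked L as \<Longrightarrow> x \<notin> {-L<..<L} \<Longrightarrow> flow_coeff L as x = 0"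
proof -
  assume "blocked L as" and x: "x \<notin> {-L<..<L}"
  then obtain a b where ab: "- L \<le> a" "a < 0" "1 < b" "b \<le> L" "Some a \<notin> set as" "Some b \<notin> set as"
    by (auto simp: blocked_def)
  show ?thesis by (rule flow_coeff_outside[OF ab(5,6,2,3)]) (use ab x in auto)
qed

text \<open>The probability that, in a cell of length \<open>h\<close>, the clocks of the window
  show exactly the pattern \<open>a\<close>.\<close>

definition jump_weight :: "real \<Rightarrow> int \<Rightarrow> int option \<Rightarrow> real" where
  "jump_weight h L a = exp (- (real (card {-L..L}) * h)) * (case a of None \<Rightarrow> 1 | Some _ \<Rightarrow> h)"

lemma prod_poisson_jump:
  assumes h: "0 < h" and as: "as \<in> jump_lists L m"
  shows "(\<Prod>v\<in>{-L..L}. \<Prod>i<m. measure_pmf.prob (poisson_pmf h) {if as ! i = Some v then 1 else 0})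
    = (\<Prod>a\<leftarrow>as. jump_weight h L a)"
proof -
  let ?B = "{-L..L}"
  have "(\<Prod>v\<in>?B. measure_pmf.prob (poisson_pmf h) {if as ! i = Some v then 1 else 0}) = jump_weight h L (as ! i)"
    if "i < m" for i
  proof -
    have mem: "as ! i \<in> insert None (Some ` ?B)"
      using as that nth_mem[of i as] unfolding jump_lists_def by blast
    have "(\<Prod>v\<in>?B. measure_pmf.prob (poisson_pmf h) {if as ! i = Some v then 1 else 0})
        = (\<Prod>v\<in>?B. exp (- h) * (if as ! i = Some v then h else 1))"
      using h by (intro prod.cong) (simp_all add: poisson_prob_0 poisson_prob_1)
    also have "\<dots> = exp (- h) ^ card ?B * (\<Prod>v\<in>?B. if as ! i = Some v then h else 1)"
      by (simp only: prod.distrib prod_constant)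
    also have "(\<Prod>v\<in>?B. if as ! i = Some v then h else 1) = (case as ! i of None \<Rightarrow> 1 | Some _ \<Rightarrow> h)"
    proof (cases "as ! i")
      case (Some w)
      then have "w \<in> ?B" using mem by auto
      then show ?thesis using Some by simp
    qed simp
    also have "exp (- h) ^ card ?B = exp (- (real (card ?B) * h))"
      by (simp only: exp_of_nat_mult[symmetric] mult_minus_right)
    finally show ?thesis by (simp only: jump_weight_def)
  qed
  then have "(\<Prod>i<m. \<Prod>v\<in>?B. measure_pmf.prob (poisson_pmf h) {if as ! i = Some v then 1 else 0})
      = (\<Prod>i<m. jump_weight h L (as ! i))"
    by (intro prod.cong) auto
  also have "\<dots> = (\<Prod>a\<leftarrow>as. jump_weight h L a)"
    using as by (simp add: prod.list_conv_set_nth jump_lists_def atLeast0LessThan)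
  finally show ?thesis by (subst prod.swap)
qed

lemma jump_weight_nonneg: "0 \<le> h \<Longrightarrow> 0 \<le> jump_weight h L a"
  by (auto simp: jump_weight_def split: option.split)

lemma jump_weight_case:
  "jump_weight h L = (\<lambda>a. case a of None \<Rightarrow> exp (- (real (card {-L..L}) * h))
    | Some _ \<Rightarrow> exp (- (real (card {-L..L}) * h)) * h)"
  by (auto simp: jump_weight_def fun_eq_iff split: option.split)

lemma jump_weight_total:
  "exp (- (real (card {-L..L}) * h)) + real (card {-L..L}) * (exp (- (real (card {-L..L}) * h)) * h) \<le> 1"
proof -
  define x where "x = real (card {-L..L}) * h"
  have "exp (- x) * (1 + x) \<le> exp (- x) * exp x"
    by (intro mult_left_mono exp_ge_add_one_self) auto
  then have "exp (- x) * (1 + x) \<le> 1" by (simp add: exp_minus)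
  then show ?thesis unfolding x_def[symmetric] by (simp add: x_def algebra_simps)
qed

lemma sum_jump_weight:
  assumes "0 \<le> h"
  shows "(\<Sum>as\<in>jump_lists L m. \<Prod>a\<leftarrow>as. jump_weight h L a)
    = (exp (- (real (card {-L..L}) * h)) * (1 + real (card {-L..L}) * h)) ^ m"
proof -
  have eq: "E + c * (E * h) = E * (1 + c * h)" for E c :: real
    by (simp add: algebra_simps)
  show ?thesis
    unfolding jump_weight_case jump_lists_def
    by (rule sum_lists_weight[OF _ _ jump_weight_total[of L h], unfolded eq]) (use assms in simp_all)
qed

text \<open>This is where the constant of the theorem arises: twice the mean energy
  \<open>1 / 2\<close>, plus 1 times a total weight of at most one.\<close>

lemma sum_jump_weight_bound:
  assumes "0 \<le> h"
  shows "(\<Sum>as\<in>{as\<in>jump_lists L m. blocked L as}.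
      (\<Prod>a\<leftarrow>as. jump_weight h L a) * (2 * flow_energy L (flow_coeff L as) + 1)) \<le> 2"
proof -
  let ?w = "\<lambda>as. \<Prod>a\<leftarrow>as. jump_weight h L a" and ?e = "\<lambda>as. flow_energy L (flow_coeff L as)"
  have w: "0 \<le> ?w as" for as
    using jump_weight_nonneg[OF assms] by (induction as) auto
  have e: "0 \<le> ?e as" for as
    by (simp add: flow_energy_def sum_nonneg)
  have "(\<Sum>as\<in>{as\<in>jump_lists L m. blocked L as}. ?w as * (2 * ?e as + 1)) \<le> (\<Sum>as\<in>jump_lists L m. ?w as * (2 * ?e as + 1))"
    using finite_jump_lists w e by (intro sum_mono2) auto
  also have "\<dots> = 2 * (\<Sum>as\<in>jump_lists L m. ?w as * ?e as) + (\<Sum>as\<in>jump_lists L m. ?w as)"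
    by (simp add: distrib_left sum.distrib sum_distrib_left mult_ac)
  also have "(\<Sum>as\<in>jump_lists L m. ?w as * ?e as) \<le> 1 / 2"
    unfolding jump_weight_case jump_lists_def
    by (rule sum_lists_flow_energy[OF _ _ jump_weight_total]) (use assms in simp_all)
  also have "(\<Sum>as\<in>jump_lists L m. ?w as) \<le> 1"
  proof -
    have "exp (- (real (card {-L..L}) * h)) * (1 + real (card {-L..L}) * h) \<le> 1"
      using jump_weight_total[of L h] by (simp add: algebra_simps)
    then show ?thesis unfolding sum_jump_weight[OF assms] using assms by (intro power_le_one) auto
  qed
  finally show ?thesis by simp
qed

section \<open>The flow on the line\<close>

locale line_meteor = meteor \<Omega> "UNIV :: int set" int_adj N M
  for \<Omega> :: "'w measure" and N M +
  fixes t :: real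
  assumes t: "0 < t"
begin

definition cell_event :: "int \<Rightarrow> int option list \<Rightarrow> 'w set" where
  "cell_event L as = grid_event \<Omega> N (t / real (length as)) (length as) {-L..L} (\<lambda>v i. {if as ! i = Some v then 1 else 0})"

text \<open>A measurable stand-in for the flow: it has the linear expression on each blocked cell
  event and is 0 elsewhere.\<close>

definition flow_approx :: "int \<Rightarrow> nat \<Rightarrow> 'w \<Rightarrow> real" where
  "flow_approx L m \<omega> = (\<Sum>as\<in>{as\<in>jump_lists L m. blocked L as}.
     indicator (cell_event L as) \<omega> * (\<Sum>x\<in>{-L..L}. flow_coeff L as x * M x 0 \<omega>))"

definition good_event :: "int \<Rightarrow> nat \<Rightarrow> 'w set" where
  "good_event L m = (\<Union>as\<in>{as\<in>jump_lists L m. blocked L as}. cell_event L as)"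

lemma cell_event_sets: "cell_event L as \<in> events"
  unfolding cell_event_def using t by (intro grid_event_sets) auto

lemma good_event_sets: "good_event L m \<in> events"
  unfolding good_event_def using finite_jump_lists cell_event_sets by (intro sets.finite_UN) auto

lemma flow_approx_measurable: "flow_approx L m \<in> borel_measurable \<Omega>"
proof -
  have [measurable]: "M x 0 \<in> borel_measurable \<Omega>" for x by (rule measurable_M) auto
  have [measurable]: "cell_event L as \<in> events" for as by (rule cell_event_sets)
  show ?thesis unfolding flow_approx_def by measurable
qed

lemma cell_event_disjoint:
  assumes "as \<in> jump_lists L m" "bs \<in> jump_lists L m" "as \<noteq> bs"
  shows "cell_event L as \<inter> cell_event L bs = {}"
proof -
  obtain i where i: "i < m" "as ! i \<noteq> bs ! i"
    using assms nth_equalityI[of as bs] by (auto simp: jump_lists_def)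
  have mem: "cs ! i \<in> insert None (Some ` {-L..L})" if "cs \<in> jump_lists L m" for cs
    using that i nth_mem[of i cs] unfolding jump_lists_def by blast
  have "\<exists>v\<in>{-L..L}. (as ! i = Some v) \<noteq> (bs ! i = Some v)"
    using mem[OF assms(1)] mem[OF assms(2)] i(2) by auto
  then obtain v where v: "v \<in> {-L..L}" "(as ! i = Some v) \<noteq> (bs ! i = Some v)" by blast
  have "N v (real (Suc i) * (t / real m)) \<omega> - N v (real i * (t / real m)) \<omega> = (if cs ! i = Some v then 1 else 0)"
    if "cs \<in> jump_lists L m" "\<omega> \<in> cell_event L cs" for cs \<omega>
    using that i(1) v(1) by (simp add: cell_event_def grid_event_def jump_lists_def)
  from this[OF assms(1)] this[OF assms(2)] v(2) show ?thesis
    by (metis (no_types, lifting) disjoint_iff zero_neq_one)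
qed

lemma flow_approx_eq:
  assumes "as \<in> jump_lists L m" "blocked L as" "\<omega> \<in> cell_event L as"
  shows "flow_approx L m \<omega> = (\<Sum>x\<in>{-L..L}. flow_coeff L as x * M x 0 \<omega>)"
proof -
  have "indicator (cell_event L bs) \<omega> * (\<Sum>x\<in>{-L..L}. flow_coeff L bs x * M x 0 \<omega>)
      = (if bs = as then (\<Sum>x\<in>{-L..L}. flow_coeff L as x * M x 0 \<omega>) else 0)"
    if "bs \<in> {as\<in>jump_lists L m. blocked L as}" for bs
    using cell_event_disjoint[of as L m bs] that assms by (auto simp: indicator_def)
  then have "flow_approx L m \<omega> = (\<Sum>bs\<in>{as\<in>jump_lists L m. blocked L as}.
      if bs = as then (\<Sum>x\<in>{-L..L}. flow_coeff L as x * M x 0 \<omega>) else 0)"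
    unfolding flow_approx_def by (rule sum.cong[OF refl])
  then show ?thesis
    using assms finite_jump_lists[of L m] by simp
qed

lemma AE_flow_rv:
  assumes m: "0 < m"
  shows "AE \<omega> in \<Omega>. \<omega> \<in> good_event L m \<longrightarrow> flow_rv N M 0 t \<omega> = flow_approx L m \<omega>"
  using AE_meteor_path AE_counting_paths[OF countableI_type]
proof eventually_elim
  case (elim \<omega>)
  show ?case
  proof
    assume "\<omega> \<in> good_event L m"
    then obtain as where as: "as \<in> jump_lists L m" "blocked L as" "\<omega> \<in> cell_event L as"
      by (auto simp: good_event_def)
    then obtain a b where ab: "- L \<le> a" "a < 0" "1 < b" "b \<le> L" "Some a \<notin> set as" "Some b \<notin> set as"
      by (auto simp: blocked_def)
    have len: "length as = m" using as by (simp add: jump_lists_def)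
    define \<tau> where "\<tau> i = real i * (t / real m)" for i
    have counting: "counting_path (\<lambda>s. N v s \<omega>)" for v using elim by simp
    have \<tau>: "0 \<le> \<tau> i" "\<tau> i \<le> \<tau> (Suc i)" for i
      using t by (auto simp: \<tau>_def intro!: mult_right_mono divide_right_mono)
    have "net_flow (\<lambda>v s. N v s \<omega>) (\<lambda>v s. M v s \<omega>) 0 t = (\<Sum>x\<in>{-L..L}. flow_coeff L as x * M x 0 \<omega>)"
    proof (rule net_flow_linear[where \<tau>=\<tau> and a=a and b=b])
      show "meteor_path UNIV int_adj (\<lambda>v s. N v s \<omega>) (\<lambda>v s. M v s \<omega>)" using elim by simp
      show "\<tau> (length as) = t" using m by (simp add: \<tau>_def len)
      show "N v (\<tau> (Suc i)) \<omega> = N v (\<tau> i) \<omega> + (if as ! i = Some v then 1 else 0)"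
        if "v \<in> {-L..L}" "i < length as" for v i
      proof -
        have "N v (\<tau> (Suc i)) \<omega> - N v (\<tau> i) \<omega> = (if as ! i = Some v then 1 else 0)"
          using as(3) that len by (auto simp: cell_event_def grid_event_def \<tau>_def)
        moreover have "N v (\<tau> i) \<omega> \<le> N v (\<tau> (Suc i)) \<omega>"
          by (rule counting_path_mono[OF counting \<tau>])
        ultimately show ?thesis by (auto split: if_splits)
      qed
    qed (use ab \<tau> counting in \<open>auto simp: \<tau>_def\<close>)
    then show "flow_rv N M 0 t \<omega> = flow_approx L m \<omega>"
      unfolding flow_rv_def flow_approx_eq[OF as] .
  qed
qed

text \<open>On each cell event the coefficients are fixed numbers, and the event is independent of
  the initial masses. So the second moment is a weighted sum of quadratic forms under the initial
  law, each controlled by the energy of its coefficients.\<close>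

lemma nn_integral_flow_approx:
  assumes m: "0 < m"
    and Q: "\<And>k. 3 \<le> k \<Longrightarrow> circle_stationary TYPE('c) k (Q k)"
    and Q_inf: "weakly_converges (\<lambda>k. periodic_law k (Q k)) (config_law \<Omega> UNIV M 0)"
  shows "(\<integral>\<^sup>+\<omega>. ennreal ((flow_approx L m \<omega>)\<^sup>2) \<partial>\<Omega>) \<le> ennreal 2"
proof -
  define h where "h = t / real m"
  have h: "0 < h" using t m by (simp add: h_def)
  let ?J = "{as\<in>jump_lists L m. blocked L as}"
  define f where "f as y = (\<Sum>x\<in>{-L..L}. flow_coeff L as x * y x)\<^sup>2" for as and y :: "int \<Rightarrow> real"
  let ?K = "\<lambda>as v i. {if as ! i = Some v then 1 else (0::nat)}"
  have meas[measurable]: "f as \<in> borel_measurable (Pi\<^sub>M UNIV (\<lambda>_. borel))" for as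
    unfolding f_def by measurable
  have fin: "finite ?J" using finite_jump_lists by simp
  have cell: "cell_event L as = grid_event \<Omega> N h m {-L..L} (?K as)" if "as \<in> ?J" for as
    using that by (simp add: cell_event_def h_def jump_lists_def)
  \<comment> \<open>The cell events are disjoint, so the square of the sum has no mixed
    terms.\<close>
  have sq: "ennreal ((flow_approx L m \<omega>)\<^sup>2) = (\<Sum>as\<in>?J. indicator (cell_event L as) \<omega> * ennreal (f as (\<lambda>v. M v 0 \<omega>)))" for \<omega>
  proof (cases "\<omega> \<in> good_event L m")
    case True
    then obtain as where as: "as \<in> jump_lists L m" "blocked L as" "\<omega> \<in> cell_event L as"
      by (auto simp: good_event_def)
    have "indicator (cell_event L bs) \<omega> * ennreal (f bs (\<lambda>v. M v 0 \<omega>)) = (if bs = as then ennreal (f as (\<lambda>v. M v 0 \<omega>)) else 0)"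
      if "bs \<in> ?J" for bs
      using cell_event_disjoint[of as L m bs] that as by (auto simp: indicator_def)
    then have "(\<Sum>as\<in>?J. indicator (cell_event L as) \<omega> * ennreal (f as (\<lambda>v. M v 0 \<omega>)))
        = (\<Sum>bs\<in>?J. if bs = as then ennreal (f as (\<lambda>v. M v 0 \<omega>)) else 0)"
      by (rule sum.cong[OF refl])
    then show ?thesis
      using as fin by (simp add: flow_approx_eq[OF as] f_def)
  next
    case False
    then have "indicator (cell_event L as) \<omega> = (0::real)" "indicator (cell_event L as) \<omega> = (0::ennreal)" if "as \<in> ?J" for as
      using that by (auto simp: good_event_def)
    then show ?thesis by (simp add: flow_approx_def)
  qed
  have [measurable]: "(\<lambda>\<omega>. M v 0 \<omega>) \<in> borel_measurable \<Omega>" for v by (rule measurable_M) auto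
  have [measurable]: "cell_event L as \<in> events" for as by (rule cell_event_sets)
  have "(\<integral>\<^sup>+\<omega>. ennreal ((flow_approx L m \<omega>)\<^sup>2) \<partial>\<Omega>)
      = (\<Sum>as\<in>?J. \<integral>\<^sup>+\<omega>. indicator (cell_event L as) \<omega> * ennreal (f as (\<lambda>v. M v 0 \<omega>)) \<partial>\<Omega>)"
    unfolding sq by (rule nn_integral_sum) (simp add: f_def)
  also have "\<dots> \<le> (\<Sum>as\<in>?J. ennreal ((\<Prod>a\<leftarrow>as. jump_weight h L a) * (2 * flow_energy L (flow_coeff L as) + 1)))"
  proof (rule sum_mono)
    fix as assume as: "as \<in> ?J"
    then have as': "as \<in> jump_lists L m" "blocked L as" by auto
    have w: "0 \<le> (\<Prod>a\<leftarrow>as. jump_weight h L a)"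
      using jump_weight_nonneg[of h] h by (induction as) auto
    have "(\<integral>\<^sup>+\<omega>. indicator (cell_event L as) \<omega> * ennreal (f as (\<lambda>v. M v 0 \<omega>)) \<partial>\<Omega>)
        = ennreal (\<Prod>a\<leftarrow>as. jump_weight h L a) * (\<integral>\<^sup>+y. ennreal (f as y) \<partial>config_law \<Omega> UNIV M 0)"
      using nn_integral_grid_event[of "{-L..L}" h "\<lambda>y. ennreal (f as y)" m "?K as"] h
      unfolding cell[OF as] prod_poisson_jump[OF h as'(1)] by (simp add: restrict_UNIV)
    also have "(\<integral>\<^sup>+y. ennreal (f as y) \<partial>config_law \<Omega> UNIV M 0)
        \<le> ennreal ((\<Sum>x\<in>{-L..<L}. (flow_coeff L as (x + 1) - flow_coeff L as x)\<^sup>2) / 2 + (\<Sum>x\<in>{-L..L}. flow_coeff L as x)\<^sup>2)"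
      unfolding f_def using Q Q_inf flow_coeff_blocked[OF as'(2)] by (rule weak_limit_quadratic_bound)
    also have "\<dots> \<le> ennreal (2 * flow_energy L (flow_coeff L as) + 1)"
      by (intro ennreal_leI gradient_le_flow_energy)
    finally show "(\<integral>\<^sup>+\<omega>. indicator (cell_event L as) \<omega> * ennreal (f as (\<lambda>v. M v 0 \<omega>)) \<partial>\<Omega>)
        \<le> ennreal ((\<Prod>a\<leftarrow>as. jump_weight h L a) * (2 * flow_energy L (flow_coeff L as) + 1))"
      using w by (simp add: ennreal_mult' mult_left_mono)
  qed
  also have "\<dots> = ennreal (\<Sum>as\<in>?J. (\<Prod>a\<leftarrow>as. jump_weight h L a) * (2 * flow_energy L (flow_coeff L as) + 1))"
  proof (rule sum_ennreal)
    fix as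
    have "0 \<le> (\<Prod>a\<leftarrow>as. jump_weight h L a)"
      using jump_weight_nonneg[of h] h by (induction as) auto
    then show "0 \<le> (\<Prod>a\<leftarrow>as. jump_weight h L a) * (2 * flow_energy L (flow_coeff L as) + 1)"
      by (auto simp: flow_energy_def sum_nonneg intro!: mult_nonneg_nonneg add_nonneg_nonneg)
  qed
  also have "\<dots> \<le> ennreal 2"
    using h by (intro ennreal_leI sum_jump_weight_bound) simp
  finally show ?thesis .
qed

end

section \<open>Probability that the approximation is exact\<close>

lemma small_mesh:
  fixes b t \<epsilon> :: real
  assumes "0 \<le> b" "0 < t" "0 < \<epsilon>"
  obtains m :: nat where "0 < m" "1 - \<epsilon> \<le> (exp (- (b * (t / real m))) * (1 + b * (t / real m))) ^ m"
proof -
  \<comment> \<open>\<open>b * t < m\<close> ensures \<open>x \<le> 1\<close> below, and the second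
    bound makes \<open>m * x\<^sup>2 = (b * t)\<^sup>2 / m\<close> at most
    \<open>\<epsilon>\<close>.\<close>
  obtain m :: nat where m: "max (b * t) ((b * t)\<^sup>2 / \<epsilon>) < real m"
    using reals_Archimedean2 by blast
  moreover have "0 \<le> b * t" using assms by simp
  ultimately have m0: "0 < m" by linarith
  define x where "x = b * (t / real m)"
  have x: "0 \<le> x" "x \<le> 1" using assms m m0 by (auto simp: x_def field_simps)
  have "x\<^sup>2 \<le> 1" using x by (simp add: power_le_one)
  have "real m * x\<^sup>2 = (b * t)\<^sup>2 / real m"
    using m0 by (simp add: x_def power2_eq_square field_simps)
  also have "\<dots> \<le> \<epsilon>"
    using m m0 assms by (simp add: field_simps)
  finally have "1 - \<epsilon> \<le> 1 + real m * (- x\<^sup>2)" by simp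
  also have "\<dots> \<le> (1 + (- x\<^sup>2)) ^ m"
    using \<open>x\<^sup>2 \<le> 1\<close> by (intro Bernoulli_inequality) simp
  also have "\<dots> \<le> (exp (- x) * (1 + x)) ^ m"
  proof (rule power_mono)
    \<comment> \<open>From \<open>1 - x \<le> exp (- x)\<close>; with Bernoulli's inequality this
      bounds the power from below.\<close>
    have "1 + (- x\<^sup>2) = (1 + (- x)) * (1 + x)" by (simp add: power2_eq_square algebra_simps)
    also have "\<dots> \<le> exp (- x) * (1 + x)"
      using x by (intro mult_right_mono exp_ge_add_one_self) auto
    finally show "1 + (- x\<^sup>2) \<le> exp (- x) * (1 + x)" .
    show "0 \<le> 1 + (- x\<^sup>2)" using \<open>x\<^sup>2 \<le> 1\<close> by simp
  qed
  finally show ?thesis using that[OF m0] by (simp add: x_def)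
qed

context line_meteor
begin

definition all_jump :: "int set \<Rightarrow> 'w set" where
  "all_jump B = grid_event \<Omega> N t 1 B (\<lambda>_ _. - {0})"

lemma all_jump_sets: "finite B \<Longrightarrow> all_jump B \<in> events"
  unfolding all_jump_def using t by (intro grid_event_sets) auto

lemma prob_all_jump:
  assumes "finite B"
  shows "prob (all_jump B) = (1 - exp (- t)) ^ card B"
proof -
  have "measure_pmf.prob (poisson_pmf t) (- {0}) = 1 - exp (- t)"
    using measure_pmf.prob_compl[of "{0}" "poisson_pmf t"] t poisson_prob_0[OF t]
    by (simp add: Compl_eq_Diff_UNIV)
  then show ?thesis
    unfolding all_jump_def using prob_grid_event[OF assms _ t, of 1] by simp
qed

text \<open>If one side of the window has no silent site, every clock there has jumped by time
  \<open>t\<close>, an event whose probability decays geometrically in the number of sites.\<close>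

lemma cell_event_unblocked:
  assumes as: "as \<in> jump_lists L m" "\<not> blocked L as" "\<omega> \<in> cell_event L as" and m: "0 < m"
    and N: "\<And>v. counting_path (\<lambda>s. N v s \<omega>)"
  shows "\<omega> \<in> all_jump {-L..-1} \<union> all_jump {2..L}"
proof -
  have len: "length as = m" using as by (simp add: jump_lists_def)
  have jump: "N v t \<omega> - N v 0 \<omega> \<noteq> 0" if v: "v \<in> {-L..L}" "Some v \<in> set as" for v
  proof -
    obtain i where i: "i < m" "as ! i = Some v"
      using v(2) len by (auto simp: in_set_conv_nth)
    have step: "N v (real (Suc i) * (t / real m)) \<omega> - N v (real i * (t / real m)) \<omega> = 1"
      using as(3) i v(1) len by (simp add: cell_event_def grid_event_def)
    have "real (Suc i) * (t / real m) \<le> real m * (t / real m)"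
      using i t by (intro mult_right_mono) auto
    then have "real (Suc i) * (t / real m) \<le> t" using m by simp
    then have "N v (real (Suc i) * (t / real m)) \<omega> \<le> N v t \<omega>"
      using t by (intro counting_path_mono[OF N]) auto
    moreover have "N v 0 \<omega> \<le> N v (real i * (t / real m)) \<omega>"
      using t by (intro counting_path_mono[OF N]) auto
    ultimately show ?thesis using step by linarith
  qed
  have "\<omega> \<in> space \<Omega>" using as(3) by (simp add: cell_event_def grid_event_def)
  have "(\<forall>a\<in>{-L..-1}. Some a \<in> set as) \<or> (\<forall>b\<in>{2..L}. Some b \<in> set as)"
  proof (rule ccontr)
    assume "\<not> ?thesis"
    then obtain a b where "a \<in> {-L..-1}" "Some a \<notin> set as" "b \<in> {2..L}" "Some b \<notin> set as" by blast
    then have "blocked L as" unfolding blocked_def by (intro exI[of _ a] exI[of _ b]) auto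
    with as(2) show False by simp
  qed
  then show ?thesis
    using jump \<open>\<omega> \<in> space \<Omega>\<close> by (auto simp: all_jump_def grid_event_def)
qed

text \<open>The first term is the probability that no cell sees two jumps in the window; the
  subtracted term is a union bound over the two sides on which silent sites may be missing.\<close>

lemma prob_good_event:
  assumes m: "0 < m" and b: "b = real (card {-int (Suc n)..int (Suc n)})"
  shows "(exp (- (b * (t / real m))) * (1 + b * (t / real m))) ^ m - 2 * (1 - exp (- t)) ^ n
    \<le> prob (good_event (int (Suc n)) m)"
proof -
  \<comment> \<open>With this choice the sites from 2 to \<open>L\<close> number exactly
    \<open>n\<close> and the negative ones \<open>n + 1\<close>.\<close>
  define L where "L = int (Suc n)"
  define h where "h = t / real m"
  have h: "0 < h" using t m by (simp add: h_def)
  let ?all = "\<Union>as\<in>jump_lists L m. cell_event L as"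
  have prob_cell: "prob (cell_event L as) = (\<Prod>a\<leftarrow>as. jump_weight h L a)" if as: "as \<in> jump_lists L m" for as
  proof -
    have "cell_event L as = grid_event \<Omega> N h m {-L..L} (\<lambda>v i. {if as ! i = Some v then 1 else 0})"
      using as by (simp add: cell_event_def h_def jump_lists_def)
    then show ?thesis
      using prob_grid_event[of "{-L..L}" h m] h prod_poisson_jump[OF h as] by simp
  qed
  have "prob ?all = (\<Sum>as\<in>jump_lists L m. prob (cell_event L as))"
    using finite_jump_lists cell_event_sets cell_event_disjoint
    by (intro finite_measure_finite_Union) (auto simp: disjoint_family_on_def)
  also have "\<dots> = (\<Sum>as\<in>jump_lists L m. \<Prod>a\<leftarrow>as. jump_weight h L a)"
    by (intro sum.cong refl prob_cell)
  also have "\<dots> = (exp (- (b * (t / real m))) * (1 + b * (t / real m))) ^ m"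
    using sum_jump_weight[OF less_imp_le[OF h], of L m] unfolding b h_def L_def .
  finally have all: "prob ?all = \<dots>" .
  have Neg: "all_jump {-L..-1} \<in> events" and Pos: "all_jump {2..L} \<in> events"
    by (auto intro: all_jump_sets)
  have "prob ?all \<le> prob (good_event L m \<union> (all_jump {-L..-1} \<union> all_jump {2..L}))"
  proof (rule finite_measure_mono_AE)
    show "AE \<omega> in \<Omega>. \<omega> \<in> ?all \<longrightarrow> \<omega> \<in> good_event L m \<union> (all_jump {-L..-1} \<union> all_jump {2..L})"
      using AE_counting_paths[OF countableI_type]
    proof eventually_elim
      case (elim \<omega>)
      then have N: "counting_path (\<lambda>s. N v s \<omega>)" for v by simp
      show ?case
      proof
        assume "\<omega> \<in> ?all"
        then obtain as where as: "as \<in> jump_lists L m" "\<omega> \<in> cell_event L as" by blast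
        show "\<omega> \<in> good_event L m \<union> (all_jump {-L..-1} \<union> all_jump {2..L})"
        proof (cases "blocked L as")
          case True
          then show ?thesis using as by (auto simp: good_event_def)
        next
          case False
          then show ?thesis using cell_event_unblocked[OF as(1) False as(2) m N] by blast
        qed
      qed
    qed
  qed (use good_event_sets Neg Pos in auto)
  also have "\<dots> \<le> prob (good_event L m) + (prob (all_jump {-L..-1}) + prob (all_jump {2..L}))"
    using measure_Un_le[OF good_event_sets sets.Un[OF Neg Pos], of L m] measure_Un_le[OF Neg Pos] by linarith
  finally have "prob ?all \<le> prob (good_event L m) + (prob (all_jump {-L..-1}) + prob (all_jump {2..L}))" .
  moreover have "prob (all_jump {-L..-1}) + prob (all_jump {2..L}) \<le> 2 * (1 - exp (- t)) ^ n"
  proof -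
    have "prob (all_jump {-L..-1}) = (1 - exp (- t)) ^ Suc n" "prob (all_jump {2..L}) = (1 - exp (- t)) ^ n"
      by (simp_all add: prob_all_jump L_def nat_add_distrib)
    moreover have "(1 - exp (- t)) ^ Suc n \<le> (1 - exp (- t)) ^ n"
      using t by (intro power_decreasing) auto
    ultimately show ?thesis by linarith
  qed
  ultimately show ?thesis using all unfolding L_def by linarith
qed

lemma exists_good_event:
  assumes "0 < \<epsilon>"
  shows "\<exists>L m. 0 < m \<and> 1 - \<epsilon> \<le> prob (good_event L m)"
proof -
  have "(\<lambda>n. (1 - exp (- t)) ^ n) \<longlonglongrightarrow> 0"
    using t by (intro LIMSEQ_power_zero) auto
  \<comment> \<open>The window is chosen before the mesh, since the mesh depends on the number of
    clocks. The two sides cost \<open>\<epsilon> / 4\<close> each and the mesh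
    \<open>\<epsilon> / 2\<close>.\<close>
  then obtain n where n: "(1 - exp (- t)) ^ n < \<epsilon> / 4"
    using order_tendstoD(2)[of _ 0 sequentially "\<epsilon> / 4"] assms
    by (auto simp: eventually_sequentially)
  obtain m where "0 < m" "1 - \<epsilon> / 2 \<le> (exp (- (real (card {-int (Suc n)..int (Suc n)}) * (t / real m))) *
      (1 + real (card {-int (Suc n)..int (Suc n)}) * (t / real m))) ^ m"
    using small_mesh[of "real (card {-int (Suc n)..int (Suc n)})" t "\<epsilon> / 2"] t assms
    by (metis half_gt_zero of_nat_0_le_iff)
  then have "1 - \<epsilon> \<le> prob (good_event (int (Suc n)) m)"
    using prob_good_event[OF \<open>0 < m\<close> refl, of n] n by linarith
  then show ?thesis using \<open>0 < m\<close> by blast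
qed

lemma flow_variance:
  assumes Q: "\<And>k. 3 \<le> k \<Longrightarrow> circle_stationary TYPE('c) k (Q k)"
    and Q_inf: "weakly_converges (\<lambda>k. periodic_law k (Q k)) (config_law \<Omega> UNIV M 0)"
  shows "integrable (completion \<Omega>) (flow_rv N M 0 t) \<and>
         integrable (completion \<Omega>) (\<lambda>\<omega>. (flow_rv N M 0 t \<omega>)\<^sup>2) \<and>
         prob_space.variance (completion \<Omega>) (flow_rv N M 0 t) \<le> 2"
proof -
  have "\<forall>j. \<exists>L m. 0 < m \<and> 1 - (1 / 2) ^ j \<le> prob (good_event L m)"
    using exists_good_event by simp
  then obtain L m where Lm: "\<And>j. 0 < m j" "\<And>j. 1 - (1 / 2) ^ j \<le> prob (good_event (L j) (m j))"
    by metis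
  show ?thesis
  proof (rule variance_bound_approximation)
    show "flow_approx (L j) (m j) \<in> borel_measurable \<Omega>" for j by (rule flow_approx_measurable)
    show "(\<integral>\<^sup>+\<omega>. ennreal ((flow_approx (L j) (m j) \<omega>)\<^sup>2) \<partial>\<Omega>) \<le> ennreal 2" for j
      by (rule nn_integral_flow_approx[OF Lm(1) Q Q_inf])
    show "AE \<omega> in \<Omega>. \<omega> \<in> good_event (L j) (m j) \<longrightarrow> flow_rv N M 0 t \<omega> = flow_approx (L j) (m j) \<omega>" for j
      by (rule AE_flow_rv[OF Lm(1)])
  qed (use Lm good_event_sets in auto)
qed

end

theorem theorem5p1:
  fixes \<Omega> :: "'w measure"
    and N :: "int \<Rightarrow> real \<Rightarrow> 'w \<Rightarrow> nat"
    and M :: "int \<Rightarrow> real \<Rightarrow> 'w \<Rightarrow> real"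
    and Q :: "nat \<Rightarrow> (int \<Rightarrow> real) measure"
    and Q_inf :: "(int \<Rightarrow> real) measure"
    and t :: real
  assumes Q: "\<And>k. 3 \<le> k \<Longrightarrow> circle_stationary TYPE('c) k (Q k)"
    and Q_inf: "weakly_converges (\<lambda>k. periodic_law k (Q k)) Q_inf"
    and M: "meteor_process \<Omega> UNIV int_adj N M"
    and M_0: "config_law \<Omega> UNIV M 0 = Q_inf"
    and t: "0 \<le> t"
  shows "integrable (completion \<Omega>) (flow_rv N M 0 t) \<and>
         integrable (completion \<Omega>) (\<lambda>\<omega>. (flow_rv N M 0 t \<omega>)\<^sup>2) \<and>
         prob_space.variance (completion \<Omega>) (flow_rv N M 0 t) \<le> 2"
proof (cases "t = 0")
  \<comment> \<open>A grid of positive mesh requires \<open>0 < t\<close>. At \<open>t = 0\<close>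
    the only summand is at time 0, where the convention for \<open>left_lim\<close> makes it
    vanish.\<close>
  case True
  have "flow_rv N M 0 t = (\<lambda>_. 0)"
    by (simp add: True flow_rv_def net_flow_def left_lim_def fun_eq_iff)
  moreover have "prob_space (completion \<Omega>)"
    using M by (intro prob_space.prob_space_completion) (simp add: meteor_process_def)
  ultimately show ?thesis
    by (simp add: prob_space.prob_space)
next
  case False
  then interpret line_meteor \<Omega> N M t
    using M t by unfold_locales auto
  show ?thesis
    by (rule flow_variance[OF Q]) (use Q_inf M_0 in simp_all)
qed

end
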